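(* Let $\mathbb{F}_q$ be a finite field of characteristic $p$, let $\mathbb{F}_Q$ ($Q=q^m$) be a finite extension of it, and let $\alpha_1,\alpha_2\in\mathbb{F}_Q^*$ be two elements which are not conjugate to each other over $\mathbb{F}_q$. For $i=1,2$ let $n_i$ be the multiplicative order of $\alpha_i$, let $\mathbb{F}_{Q_i}=\mathbb{F}_q(\alpha_i)$ with $Q_i=q^{k_i}$, let $\gamma_i$ be a primitive element of $\mathbb{F}_{Q_i}$ with $\alpha_i=\gamma_i^{e_i}$ and $Q_i-1=e_in_i$, and let $n=n_1n_2/\gcd(n_1,n_2)$. Let $C=\{c(\beta_1,\beta_2):\beta_1\in\mathbb{F}_{Q_1},\beta_2\in\mathbb{F}_{Q_2}\}\subset\mathbb{F}_q^n$ and $C'=\{c(0,\beta_2):\beta_2\in\mathbb{F}_{Q_2}\}\subset C$, where $c(\beta_1,\beta_2)=\big(T_q^{Q_1}(\beta_1\alpha_1^i)+T_q^{Q_2}(\beta_2\alpha_2^i)\big)_{0\le i\le n-1}$. Let $\chi$ be the multiplicative character of $\mathbb{F}_{Q_1}$ with $\chi(\gamma_1)=\zeta_{e_1}$. Then for every $1\le j\le k_1$, $$M_j(C,C')=n-\max_{H}\left(\frac{n}{q^j}+\frac{1}{q^j}\big(A(H)+B(H)\big)\right),$$ where $H$ runs over all $j$-dimensional $\mathbb{F}_q$-linear subspaces of $\mathbb{F}_{Q_1}\times\mathbb{F}_{Q_2}$ with $H\cap(\{0\}\times\mathbb{F}_{Q_2})=\{(0,0)\}$, and $$A(H)=\frac{n}{e_1n_1}\sum_{\substack{0\le\lambda\le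 e_1-1\\ \chi^{\lambda}(\mathbb{F}_q^* )=1}}G_{Q_1}(\chi^{\lambda})\sum_{(\beta_1,0)\in H,\ \beta_1\neq 0}\bar{\chi}^{\lambda}(\beta_1),$$ $$B(H)=\sum_{(\beta_1,\beta_2)\in H,\ \beta_1\beta_2\neq 0}\ \sum_{i=0}^{n-1}\zeta_p^{T_p^{Q_1}(\beta_1\alpha_1^i)+T_p^{Q_2}(\beta_2\alpha_2^i)}.$$
   Context: $T_q^{Q_i}$ and $T_p^{Q_i}$ denote the trace maps from $\mathbb{F}_{Q_i}$ to $\mathbb{F}_q$ and to $\mathbb{F}_p$, respectively. $\zeta_l=e^{2\pi\sqrt{-1}/l}$. A multiplicative character of a finite field is a homomorphism from its multiplicative group to $\mathbb{C}^*$; $\bar\chi$ is the complex conjugate of $\chi$; the condition $\chi^\lambda(\mathbb{F}_q^* )=1$ means that $\chi^\lambda$ is trivial on $\mathbb{F}_q^*$. The Gauss sum is $G_{Q_1}(\psi)=\sum_{x\in\mathbb{F}_{Q_1}^*}\psi(x)\zeta_p^{T_p^{Q_1}(x)}$. In the condition $\beta_1\beta_2\ne 0$ the meaning is that both $\beta_1\neq0$ and $\beta_2\ne 0$. For an $\mathbb{F}_q$-linear subspace $D\subset\mathbb{F}_q^n$, $\mathrm{Supp}(D)$ is the set of coordinate positions $i$ such that $v_i\neq 0$ for some $v\in D$. For linear codes $C'\subset C\subset \mathbb{F}_q^n$ and $1\le j\le \dim C-\dim C'$, the $j$th relative generalized Hamming weight of $C$ with respect to $C'$ is $$M_j(C,C')=\min\{|\mathrm{Supp}(D)|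 : D\subset C \text{ an } \mathbb{F}_q\text{-linear subspace},\ \dim D=j,\ D\cap C'=\{0\}\}.$$ Here $\dim C=k_1+k_2$ and $\dim C'=k_2$. *)

theory Defs
  imports
    "HOL-Library.Function_Algebras"
    "HOL-Library.Product_Plus"
    "HOL-Library.Cardinality"
    "HOL-Computational_Algebra.Computational_Algebra"
begin

text \<open>
  The base field is the type 'k and the extension is the type 'a; the base field sits inside
  the extension through an embedding \<open>emb\<close>. Intermediate fields are subsets of 'a.
  With scalars in a type, the linear algebra of \<^theory>\<open>HOL.Vector_Spaces\<close> applies as it is.
\<close>

definition field_embedding :: "('k::field \<Rightarrow> 'a::field) \<Rightarrow> bool" where
  "field_embedding emb \<longleftrightarrow>
     (\<forall>x y. emb (x + y) = emb x + emb y) \<and> (\<forall>x y. emb (x * y) = emb x * emb y) \<and> emb 1 = 1"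

definition is_subfield :: "'a::field set \<Rightarrow> bool" where
  "is_subfield L \<longleftrightarrow> 0 \<in> L \<and> 1 \<in> L \<and>
     (\<forall>x\<in>L. \<forall>y\<in>L. x + y \<in> L \<and> x * y \<in> L) \<and> (\<forall>x\<in>L. - x \<in> L \<and> inverse x \<in> L)"

definition adjoin :: "('k::field \<Rightarrow> 'a::field) \<Rightarrow> 'a \<Rightarrow> 'a set" where
  "adjoin emb \<alpha> = is_subfield hull (insert \<alpha> (range emb))"

text \<open>Up to a unit, \<open>f\<close> is the common minimal polynomial of \<open>x\<close> and \<open>y\<close> over the base field.\<close>

definition conjugate_over :: "('k::field \<Rightarrow> 'a::field) \<Rightarrow> 'a \<Rightarrow> 'a \<Rightarrow> bool" where
  "conjugate_over emb x y \<longleftrightarrow>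
     (\<exists>f :: 'k poly. irreducible f \<and> poly (map_poly emb f) x = 0 \<and> poly (map_poly emb f) y = 0)"

definition mult_order :: "'a::field \<Rightarrow> nat" where
  "mult_order x = (LEAST n. 0 < n \<and> x ^ n = 1)"

definition primitive_element :: "'a::field set \<Rightarrow> 'a \<Rightarrow> bool" where
  "primitive_element L \<gamma> \<longleftrightarrow> L - {0} = range (\<lambda>i::nat. \<gamma> ^ i)"

text \<open>
  Trace of a finite field \<open>L\<close> of order \<open>r\<^sup>k\<close> to its subfield of order \<open>r\<close>: the sum of the
  \<open>k\<close> conjugates \<open>x\<^bsup>r^t\<^esup>\<close>, as an element of \<open>L\<close>.
\<close>

definition field_trace :: "nat \<Rightarrow> 'a::field set \<Rightarrow> 'a \<Rightarrow> 'a" where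
  "field_trace r L x = (\<Sum>t < (THE k. card L = r ^ k). x ^ (r ^ t))"

definition base_trace :: "('k::{field,finite} \<Rightarrow> 'a::field) \<Rightarrow> 'a set \<Rightarrow> 'a \<Rightarrow> 'k" where
  "base_trace emb L x = inv emb (field_trace CARD('k) L x)"

definition zeta :: "nat \<Rightarrow> complex" where
  "zeta l = exp (2 * of_real pi * \<i> / of_nat l)"

text \<open>\<open>\<zeta>\<^sub>p\<^sup>x\<close> for \<open>x\<close> in the prime field of order \<open>p\<close>.\<close>

definition zeta_pow :: "nat \<Rightarrow> 'a::field \<Rightarrow> complex" where
  "zeta_pow p x = zeta p ^ (THE j. j < p \<and> of_nat j = x)"

definition mult_character :: "'a::field set \<Rightarrow> ('a \<Rightarrow> complex) \<Rightarrow> bool" where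
  "mult_character L \<chi> \<longleftrightarrow>
     (\<forall>x\<in>L - {0}. \<chi> x \<noteq> 0) \<and> (\<forall>x\<in>L - {0}. \<forall>y\<in>L - {0}. \<chi> (x * y) = \<chi> x * \<chi> y)"

definition gauss_sum :: "nat \<Rightarrow> 'a::field set \<Rightarrow> ('a \<Rightarrow> complex) \<Rightarrow> complex" where
  "gauss_sum p L \<psi> = (\<Sum>x\<in>L - {0}. \<psi> x * zeta_pow p (field_trace p L x))"

text \<open>
  A word of length \<open>n\<close> is a function on the natural numbers that vanishes at all \<open>i \<ge> n\<close>.
\<close>

definition word_scale :: "'k::field \<Rightarrow> (nat \<Rightarrow> 'k) \<Rightarrow> nat \<Rightarrow> 'k" where
  "word_scale a v = (\<lambda>i. a * v i)"

lemma vector_space_word_scale: "vector_space word_scale"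
  by unfold_locales (auto simp: word_scale_def fun_eq_iff algebra_simps)

definition Supp :: "(nat \<Rightarrow> 'k::field) set \<Rightarrow> nat set" where
  "Supp D = {i. \<exists>v\<in>D. v i \<noteq> 0}"

text \<open>Meaningful for \<open>1 \<le> j \<le> dim C - dim C'\<close>: the set is then nonempty.\<close>

definition rghw :: "nat \<Rightarrow> (nat \<Rightarrow> 'k::field) set \<Rightarrow> (nat \<Rightarrow> 'k) set \<Rightarrow> nat" where
  "rghw j C C' =
     Min {card (Supp D) | D. module.subspace word_scale D \<and> D \<subseteq> C \<and>
            vector_space.dim word_scale D = j \<and> D \<inter> C' = {0}}"

definition cyclic_word ::
  "('k::{field,finite} \<Rightarrow> 'a::field) \<Rightarrow> nat \<Rightarrow> 'a set \<Rightarrow> 'a \<Rightarrow> 'a set \<Rightarrow> 'a \<Rightarrow> 'a \<Rightarrow> 'a \<Rightarrow> nat \<Rightarrow> 'k"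
where
  "cyclic_word emb n F\<^sub>1 \<alpha>\<^sub>1 F\<^sub>2 \<alpha>\<^sub>2 \<beta>\<^sub>1 \<beta>\<^sub>2 =
     (\<lambda>i. if i < n then base_trace emb F\<^sub>1 (\<beta>\<^sub>1 * \<alpha>\<^sub>1 ^ i) + base_trace emb F\<^sub>2 (\<beta>\<^sub>2 * \<alpha>\<^sub>2 ^ i) else 0)"

definition pair_scale :: "('k::field \<Rightarrow> 'a::field) \<Rightarrow> 'k \<Rightarrow> 'a \<times> 'a \<Rightarrow> 'a \<times> 'a" where
  "pair_scale emb a x = (emb a * fst x, emb a * snd x)"

lemma vector_space_pair_scale:
  assumes "field_embedding emb"
  shows "vector_space (pair_scale emb)"
  using assms
  by unfold_locales (auto simp: pair_scale_def field_embedding_def prod_eq_iff algebra_simps)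

end

theory Submission
  imports Defs "HOL-Number_Theory.Cong"
begin

text \<open>
  The map \<open>(\<beta>\<^sub>1, \<beta>\<^sub>2) \<mapsto> c(\<beta>\<^sub>1, \<beta>\<^sub>2)\<close> is injective: evaluating multiples of the minimal polynomial of \<open>\<alpha>\<^sub>2\<close>
  at the conjugacy-distinct \<open>\<alpha>\<^sub>1\<close> isolates \<open>\<beta>\<^sub>1\<close>, and the trace form is nondegenerate. Hence the subspaces
  \<open>D\<close> in the definition of \<open>M\<^sub>j(C, C')\<close> are the images of the subspaces \<open>H\<close>, and \<open>n - |Supp(D)|\<close> counts
  the positions at which all words of \<open>D\<close> vanish. Orthogonality of additive characters on \<open>H\<close> turns
  \<open>q\<^sup>j\<close> times this count into an exponential sum over \<open>H\<close>. The zero pair contributes \<open>n\<close>, the pairs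
  with both entries nonzero give \<open>B(H)\<close>, and for the pairs \<open>(\<beta>\<^sub>1, 0)\<close> Fourier inversion over the powers
  of \<open>\<chi>\<close> yields Gauss sums; invariance of \<open>H\<close> under scalars kills those \<open>\<chi>\<^sup>\<lambda>\<close> that are nontrivial on
  the base field.
\<close>

section \<open>Counting vectors over a finite field\<close>

text \<open>By induction on the basis: a vector in the span of \<open>insert b B\<close> is
  \<open>scale c b + v\<close> for exactly one scalar \<open>c\<close> and one \<open>v\<close> in
  the span of \<open>B\<close>, so each basis vector multiplies the cardinality by the size of the
  field.\<close>

lemma (in vector_space) card_span_independent:
  assumes "finite (UNIV :: 'a set)" "finite B" "independent B"
  shows "finite (span B) \<and> card (span B) = CARD('a) ^ card B"
  using assms(2,3)
proof (induction B rule: finite_induct)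
  case empty
  then show ?case by simp
next
  case (insert b B)
  then have B: "independent B" and b: "b \<notin> span B"
    by (auto simp: independent_insert)
  note IH = insert.IH[OF B]
  let ?f = "\<lambda>(c, v). scale c b + v"
  have "inj_on ?f (UNIV \<times> span B)"
  proof (rule inj_onI, clarify)
    fix c v c' v' assume v: "v \<in> span B" "v' \<in> span B" and eq: "scale c b + v = scale c' b + v'"
    have "scale (c - c') b = v' - v"
      using eq by (simp add: scale_left_diff_distrib algebra_simps)
    then have mem: "scale (c - c') b \<in> span B"
      using v by (simp add: span_diff)
    have "c = c'"
    proof (rule ccontr)
      assume "c \<noteq> c'"
      then have "b = scale (inverse (c - c')) (scale (c - c') b)"
        by simp
      then show False
        using b span_scale[OF mem] by metis
    qed
    with eq show "c = c' \<and> v = v'" by simp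
  qed
  moreover have "?f ` (UNIV \<times> span B) = span (insert b B)"
  proof (rule set_eqI)
    fix x
    have "x \<in> span (insert b B) \<longleftrightarrow> (\<exists>k. x - scale k b \<in> span B)"
      by (simp add: span_insert)
    also have "\<dots> \<longleftrightarrow> x \<in> ?f ` (UNIV \<times> span B)"
    proof
      assume "\<exists>k. x - scale k b \<in> span B"
      then obtain k where k: "x - scale k b \<in> span B" by blast
      show "x \<in> ?f ` (UNIV \<times> span B)"
        by (rule image_eqI[of _ _ "(k, x - scale k b)"]) (use k in auto)
    next
      assume "x \<in> ?f ` (UNIV \<times> span B)"
      then obtain c v where cv: "v \<in> span B" "x = scale c b + v" by auto
      then have "x - scale c b = v" by simp
      with cv show "\<exists>k. x - scale k b \<in> span B" by metis
    qed
    finally show "x \<in> ?f ` (UNIV \<times> span B) \<longleftrightarrow> x \<in> span (insert b B)" ..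
  qed
  ultimately have "bij_betw ?f (UNIV \<times> span B) (span (insert b B))"
    by (simp add: bij_betw_def)
  from bij_betw_finite[OF this] bij_betw_same_card[OF this] show ?case
    using IH insert.hyps assms(1) by (simp add: card_cartesian_product)
qed

text \<open>Translates between cardinality and dimension; bijections between subspaces become
  equalities of dimensions this way.\<close>

lemma card_subspace_eq_power_dim:
  fixes scale :: "'k::{field,finite} \<Rightarrow> 'b::ab_group_add \<Rightarrow> 'b"
  assumes "vector_space scale" "module.subspace scale V" "finite V"
  shows "card V = CARD('k) ^ vector_space.dim scale V"
proof -
  interpret vector_space scale by fact
  obtain B where B: "B \<subseteq> V" "independent B" "V \<subseteq> span B" "card B = dim V"
    using basis_exists by blast
  have "span B = V"
    using B(1,3) assms(2) by (simp add: span_minimal subset_antisym)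
  with card_span_independent[of B] B finite_subset[OF B(1) assms(3)] show ?thesis
    by simp
qed

text \<open>Any \<open>j\<close> vectors of a basis of \<open>V\<close> span such a
  subspace.\<close>

lemma exists_subspace_of_dim:
  fixes scale :: "'k::field \<Rightarrow> 'b::ab_group_add \<Rightarrow> 'b"
  assumes "vector_space scale" "module.subspace scale V" "j \<le> vector_space.dim scale V"
  obtains W where "W \<subseteq> V" "module.subspace scale W" "vector_space.dim scale W = j"
proof -
  interpret vector_space scale by fact
  obtain B where B: "B \<subseteq> V" "independent B" "V \<subseteq> span B" "card B = dim V"
    using basis_exists by blast
  obtain S where S: "S \<subseteq> B" "card S = j"
    using obtain_subset_with_card_n[of j B] assms(3) B(4) by auto
  have "independent S"
    using B(2) S(1) independent_mono by blast
  then show thesis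
    using that[of "span S"] S B(1) assms(2) span_minimal[of S V] by (auto simp: dim_eq_card_independent)
qed

section \<open>Finite fields\<close>

lemma sum_lessThan_mult:
  fixes f :: "nat \<Rightarrow> 'b::comm_monoid_add"
  shows "(\<Sum>i<k * s. f i) = (\<Sum>t<k. \<Sum>u<s. f (t * s + u))"
proof -
  have "(\<Sum>i\<in>{t * s..<t * s + s}. f i) = (\<Sum>u<s. f (t * s + u))" for t
    by (rule sum.reindex_bij_witness[of _ "\<lambda>u. t * s + u" "\<lambda>i. i - t * s"]) auto
  then show ?thesis using sum.nat_group[of f s k] by simp
qed

lemma prime_CHAR_finite_field: "prime CHAR('k::{field,finite})"
  by (simp add: finite_imp_CHAR_pos prime_CHAR_semidom)

lemma CARD_field_gt_1: "1 < CARD('k::{field,finite})"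
proof -
  have "card {0, 1 :: 'k} \<le> CARD('k)" by (rule card_mono) auto
  then show ?thesis by simp
qed

text \<open>\<open>S\<close> is an additive subgroup and \<open>T\<close> the subgroup generated by
  \<open>S\<close> and \<open>x\<close>. If \<open>of_int (i - i') * x\<close> were in
  \<open>S\<close> with \<open>i - i'\<close> prime to the characteristic, Bezout would put
  \<open>x\<close> itself into \<open>S\<close>; so the \<open>CHAR('k)\<close> cosets of
  \<open>S\<close> by multiples of \<open>x\<close> are distinct.\<close>

lemma card_additive_extension:
  fixes S :: "'k::{field,finite} set"
  assumes S: "0 \<in> S" "\<And>x y. x \<in> S \<Longrightarrow> y \<in> S \<Longrightarrow> x - y \<in> S" and x: "x \<notin> S"
  defines "T \<equiv> {of_int i * x + y | i y. y \<in> S}"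
  shows "0 \<in> T" "\<And>u v. u \<in> T \<Longrightarrow> v \<in> T \<Longrightarrow> u - v \<in> T" "card T = CHAR('k) * card S"
proof -
  let ?p = "int CHAR('k)"
  have p: "prime ?p" using prime_CHAR_finite_field by simp
  show "0 \<in> T" unfolding T_def using S(1) by (auto intro!: exI[of _ 0])
  show "u - v \<in> T" if uv: "u \<in> T" "v \<in> T" for u v
  proof -
    obtain i y i' y' where "u = of_int i * x + y" "v = of_int i' * x + y'" "y \<in> S" "y' \<in> S"
      using uv unfolding T_def by blast
    then have "u - v = of_int (i - i') * x + (y - y')" "y - y' \<in> S"
      using S(2) by (auto simp: algebra_simps)
    then show ?thesis unfolding T_def by blast
  qed
  have minus: "- y \<in> S" if "y \<in> S" for y
    using S(2)[OF S(1) that] by simp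
  have add: "y + z \<in> S" if "y \<in> S" "z \<in> S" for y z
    using S(2)[OF that(1) minus[OF that(2)]] by simp
  have nat_mult: "of_nat m * y \<in> S" if "y \<in> S" for m y
    by (induction m) (use S(1) that add in \<open>auto simp: algebra_simps\<close>)
  have int_mult: "of_int m * y \<in> S" if "y \<in> S" for m y
    by (cases m rule: int_cases2) (use nat_mult[OF that] minus in auto)
  let ?f = "\<lambda>(i, y). of_int i * x + y"
  have inj: "inj_on ?f ({0..<?p} \<times> S)"
  proof (rule inj_onI, clarify)
    fix i y i' y'
    assume i: "i \<in> {0..<?p}" "i' \<in> {0..<?p}" and y: "y \<in> S" "y' \<in> S"
      and eq: "of_int i * x + y = of_int i' * x + y'"
    have "of_int (i - i') * x = y' - y" using eq by (simp add: algebra_simps)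
    then have mem: "of_int (i - i') * x \<in> S" using S(2) y by simp
    have "i = i'"
    proof (rule ccontr)
      assume "i \<noteq> i'"
      then have "\<not> ?p dvd i - i'" using i dvd_imp_le_int[of "i - i'" ?p] by auto
      then have "coprime ?p (i - i')" using p prime_imp_coprime by blast
      then obtain u v where "u * (i - i') + v * ?p = 1"
        by (metis add.commute bezout_int coprime_imp_gcd_eq_1)
      then have "(of_int (u * (i - i') + v * ?p) :: 'k) = 1" by simp
      then have "of_int u * (of_int (i - i') :: 'k) = 1" by simp
      then have "x = of_int u * (of_int (i - i') * x)" by (simp add: mult.assoc[symmetric])
      with int_mult[OF mem] x show False by metis
    qed
    with eq show "i = i' \<and> y = y'" by simp
  qed
  have "?f ` ({0..<?p} \<times> S) = T"
  proof (intro equalityI subsetI)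
    fix t assume "t \<in> T"
    then obtain i y where iy: "t = of_int i * x + y" "y \<in> S" unfolding T_def by blast
    have "(of_int (i mod ?p) :: 'k) = of_int i"
      by (simp add: of_int_eq_iff_cong_CHAR cong_def)
    then show "t \<in> ?f ` ({0..<?p} \<times> S)"
      using iy prime_gt_0_int[OF p] by (intro image_eqI[of _ _ "(i mod ?p, y)"]) auto
  qed (auto simp: T_def)
  then show "card T = CHAR('k) * card S"
    using card_image[OF inj] by (simp add: card_cartesian_product)
qed

text \<open>Among the additive subgroups whose order is a power of the characteristic, a largest one
  is the whole field, since \<open>card_additive_extension\<close> enlarges any proper one.\<close>

lemma CARD_eq_power_CHAR:
  obtains s where "CARD('k::{field,finite}) = CHAR('k) ^ s" "s > 0"
proof -
  let ?P = "\<lambda>S :: 'k set. 0 \<in> S \<and> (\<forall>x\<in>S. \<forall>y\<in>S. x - y \<in> S) \<and> (\<exists>s. card S = CHAR('k) ^ s)"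
  have P0: "?P {0}" by (auto intro: exI[of _ 0])
  have bound: "\<forall>T. ?P T \<longrightarrow> card T < Suc CARD('k)" by (auto simp: less_Suc_eq_le intro: card_mono)
  obtain S where S: "?P S" and max: "\<And>T. ?P T \<Longrightarrow> card T \<le> card S"
    using ex_has_greatest_nat[OF P0 bound] by blast
  have "S = UNIV"
  proof (rule ccontr)
    assume "S \<noteq> UNIV"
    then obtain x where x: "x \<notin> S" by blast
    define T where "T = {of_int i * x + y | i y. y \<in> S}"
    have T: "0 \<in> T" "\<And>u v. u \<in> T \<Longrightarrow> v \<in> T \<Longrightarrow> u - v \<in> T" "card T = CHAR('k) * card S"
      using card_additive_extension[of S x] S x unfolding T_def by blast+
    moreover obtain s where "card S = CHAR('k) ^ s" using S by blast
    ultimately have "?P T" by (auto intro!: exI[of _ "Suc s"])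
    from max[OF this] T(3) prime_gt_1_nat[OF prime_CHAR_finite_field[where 'k = 'k]]
    have "card S = 0" by simp
    with S show False by simp
  qed
  with S obtain s where s: "CARD('k) = CHAR('k) ^ s" by auto
  with CARD_field_gt_1[where 'k = 'k] have "s > 0" by (cases s) auto
  with s show thesis using that by blast
qed

text \<open>Otherwise the polynomials \<open>X ^ m\<close> and \<open>X\<close> would agree at more
  than \<open>m\<close> points and be equal. This identifies the prime field and the embedded base
  field as the fixed points of a power map.\<close>

lemma mem_of_power_eq_self:
  fixes x :: "'a::field"
  assumes "\<And>y. y \<in> S \<Longrightarrow> y ^ m = y" "card S \<ge> m" "m > 1" "finite S" "x ^ m = x"
  shows "x \<in> S"
proof (rule ccontr)
  assume "x \<notin> S"
  let ?p = "monom 1 m :: 'a poly"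
  have "?p = [:0, 1:]"
    by (rule poly_eqI_degree[of "insert x S"])
      (use assms \<open>x \<notin> S\<close> in \<open>auto simp: poly_monom degree_monom_eq\<close>)
  then have "degree ?p = 1" by simp
  then show False using assms(3) by (simp add: degree_monom_eq)
qed

text \<open>Multiplication by \<open>x \<noteq> 0\<close> permutes the nonzero elements of
  \<open>L\<close>; their product is unchanged and cancels.\<close>

lemma subfield_power_card:
  assumes "is_subfield L" "finite L" "x \<in> L"
  shows "x ^ card L = x" "x \<noteq> 0 \<Longrightarrow> x ^ (card L - 1) = 1"
proof -
  have L: "0 \<in> L" "\<And>x y. x \<in> L \<Longrightarrow> y \<in> L \<Longrightarrow> x * y \<in> L" "\<And>x. x \<in> L \<Longrightarrow> inverse x \<in> L"
    using assms(1) by (auto simp: is_subfield_def)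
  show *: "x ^ (card L - 1) = 1" if "x \<noteq> 0"
  proof -
    have "(\<Prod>y\<in>L - {0}. x * y) = (\<Prod>y\<in>L - {0}. y)"
      by (rule prod.reindex_bij_witness[of _ "\<lambda>y. inverse x * y" "\<lambda>y. x * y"])
        (use that L assms(3) in auto)
    then have "x ^ (card L - 1) * \<Prod>(L - {0}) = \<Prod>(L - {0})"
      using L(1) assms(2) by (simp add: prod.distrib card_Diff_singleton)
    moreover have "\<Prod>(L - {0}) \<noteq> 0" using assms(2) by simp
    ultimately show ?thesis by simp
  qed
  have "card L > 0" using L(1) assms(2) by (auto simp: card_gt_0_iff)
  then show "x ^ card L = x"
    using * by (cases "x = 0") (auto simp: power_eq_if)
qed

lemma field_trace_eq:
  assumes "card L = r ^ k" "r > 1"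
  shows "field_trace r L x = (\<Sum>t<k. x ^ (r ^ t))"
proof -
  have "(THE k. card L = r ^ k) = k"
    using assms by (intro the_equality) auto
  then show ?thesis by (simp add: field_trace_def)
qed

text \<open>The trace is a polynomial function of degree at most \<open>r ^ (k - 1)\<close>, less
  than \<open>card L\<close>; vanishing on all of \<open>L\<close> would make the polynomial
  zero.\<close>

lemma field_trace_not_all_zero:
  fixes L :: "'a::field set"
  assumes "card L = r ^ k" "r > 1" "k > 0"
  obtains x where "x \<in> L" "field_trace r L x \<noteq> 0"
proof (rule ccontr)
  assume "\<not> thesis"
  with that have zero: "field_trace r L x = 0" if "x \<in> L" for x using that by blast
  let ?p = "\<Sum>t<k. monom 1 (r ^ t) :: 'a poly"
  have "degree ?p \<le> r ^ (k - 1)"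
    by (rule degree_sum_le)
      (use assms in \<open>auto simp: degree_monom_eq intro: power_increasing\<close>)
  also have "\<dots> < r ^ k" using assms by (auto intro: power_strict_increasing)
  finally have "?p = 0"
    by (intro poly_eqI_degree[of L])
      (use assms zero in \<open>auto simp: poly_sum poly_monom field_trace_eq\<close>)
  \<comment> \<open>Only the monomial with \<open>t = 0\<close> has degree 1, so this coefficient is
    1.\<close>
  moreover have "coeff ?p 1 = (\<Sum>t<k. if t = 0 then 1 else 0)"
    unfolding coeff_sum by (rule sum.cong) (use assms in \<open>auto simp: power_eq_if\<close>)
  ultimately show False using assms(3) by simp
qed

lemma power_CHAR_additive:
  fixes x y :: "'a::{field,finite}"
  assumes "r = CHAR('a) ^ s"
  shows "(x + y) ^ (r ^ t) = x ^ (r ^ t) + y ^ (r ^ t)"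
    "(\<Sum>i\<in>I. f i) ^ (r ^ t) = (\<Sum>i\<in>I. f i ^ (r ^ t) :: 'a)"
proof -
  have r: "r ^ t = CHAR('a) ^ (s * t)" by (simp add: assms power_mult)
  show "(x + y) ^ (r ^ t) = x ^ (r ^ t) + y ^ (r ^ t)"
    by (rule freshmans_dream'[OF prime_CHAR_finite_field r])
  show "(\<Sum>i\<in>I. f i) ^ (r ^ t) = (\<Sum>i\<in>I. f i ^ (r ^ t) :: 'a)"
    by (rule freshmans_dream_sum'[OF prime_CHAR_finite_field r])
qed

lemma field_trace_add:
  fixes x y :: "'a::{field,finite}"
  assumes "r = CHAR('a) ^ s"
  shows "field_trace r L (x + y) = field_trace r L x + field_trace r L y"
  unfolding field_trace_def power_CHAR_additive(1)[OF assms] by (rule sum.distrib)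

text \<open>Raising to the power \<open>r\<close> shifts the conjugates \<open>x ^ (r ^ t)\<close>
  cyclically, because \<open>x ^ (r ^ k) = x\<close>.\<close>

lemma field_trace_power:
  fixes x :: "'a::{field,finite}"
  assumes "r = CHAR('a) ^ s" "r > 1" "card L = r ^ k" "is_subfield L" "x \<in> L"
  shows "field_trace r L x ^ r = field_trace r L x"
proof -
  have xk: "x ^ (r ^ k) = x"
    using subfield_power_card(1)[OF assms(4) _ assms(5)] assms(3) by simp
  have "field_trace r L x ^ r = (\<Sum>t<k. x ^ (r ^ Suc t))"
    using power_CHAR_additive(2)[OF assms(1), where t = 1 and I = "{..<k}"]
    by (simp add: field_trace_eq[OF assms(3,2)] mult.commute[of r] power_mult)
  also have "\<dots> = (\<Sum>t<k. x ^ (r ^ t))"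
  proof -
    have "(\<Sum>t<Suc k. x ^ (r ^ t)) = x + (\<Sum>t<k. x ^ (r ^ Suc t))"
      by (subst sum.lessThan_Suc_shift) simp
    moreover have "(\<Sum>t<Suc k. x ^ (r ^ t)) = (\<Sum>t<k. x ^ (r ^ t)) + x"
      using xk by simp
    ultimately show ?thesis by (simp add: add.commute)
  qed
  finally show ?thesis by (simp add: field_trace_eq[OF assms(3,2)])
qed

section \<open>Characters\<close>

lemma zeta_power: "zeta l ^ j = cis (2 * pi * real j / real l)"
  unfolding zeta_def exp_of_nat_mult[symmetric] cis_conv_exp
  by (simp add: mult_ac)

lemma zeta_power_self [simp]: "l > 0 \<Longrightarrow> zeta l ^ l = 1"
  by (simp add: zeta_power)

lemma norm_zeta [simp]: "norm (zeta l) = 1"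
  using zeta_power[of l 1] by simp

text \<open>The exponent may be reduced modulo \<open>l\<close>, and the powers below
  \<open>l\<close> are distinct roots of unity.\<close>

lemma zeta_power_eq_1_iff:
  assumes "l > 0"
  shows "zeta l ^ j = 1 \<longleftrightarrow> l dvd j"
proof -
  have "zeta l ^ j = zeta l ^ (l * (j div l) + j mod l)" by simp
  also have "\<dots> = zeta l ^ (j mod l)"
    using assms by (simp only: power_add power_mult) simp
  also have "\<dots> = 1 \<longleftrightarrow> j mod l = 0"
  proof
    assume "zeta l ^ (j mod l) = 1"
    then have "cis (2 * pi * real (j mod l) / real l) = cis (2 * pi * real 0 / real l)"
      by (simp add: zeta_power)
    with inj_onD[OF bij_betw_imp_inj_on[OF bij_betw_roots_unity[OF assms]] this] assms
    show "j mod l = 0" by simp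
  qed simp
  finally show ?thesis by (simp add: dvd_eq_mod_eq_0)
qed

text \<open>A geometric series whose ratio is an \<open>l\<close>-th root of unity.\<close>

lemma sum_zeta_powers:
  assumes "l > 0"
  shows "(\<Sum>k<l. zeta l ^ (j * k)) = (if l dvd j then of_nat l else 0)"
proof (cases "l dvd j")
  case True
  then show ?thesis
    using zeta_power_eq_1_iff[OF assms, of j] by (simp add: power_mult)
next
  case False
  have "(zeta l ^ j) ^ l = 1"
    using assms by (simp only: mult.commute[of j] power_mult[symmetric]) (simp add: power_mult)
  then show ?thesis
    using False geometric_sum[of "zeta l ^ j" l] zeta_power_eq_1_iff[OF assms, of j]
    by (simp add: power_mult)
qed

text \<open>The \<open>CHAR('a)\<close> distinct multiples of 1 already exhaust the solutions of
  \<open>x ^ CHAR('a) = x\<close>. Hence the \<open>THE\<close> in \<open>zeta_pow\<close> is well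
  defined on them.\<close>

lemma prime_field_unique_of_nat:
  fixes x :: "'a::{field,finite}"
  assumes "x ^ CHAR('a) = x"
  shows "\<exists>!j. j < CHAR('a) \<and> of_nat j = x"
proof -
  let ?S = "(of_nat :: nat \<Rightarrow> 'a) ` {..<CHAR('a)}"
  note p = prime_CHAR_finite_field[where 'k = 'a]
  have inj: "inj_on (of_nat :: nat \<Rightarrow> 'a) {..<CHAR('a)}"
    by (auto simp: inj_on_def of_nat_eq_iff_cong_CHAR cong_def)
  have "x \<in> ?S"
  proof (rule mem_of_power_eq_self[OF _ _ _ _ assms])
    fix y :: 'a assume "y \<in> ?S"
    then obtain j where j: "y = of_nat j" by blast
    \<comment> \<open>Fermat's little theorem, by induction with the freshman's dream.\<close>
    have "(of_nat j :: 'a) ^ CHAR('a) = of_nat j"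
      using p by (induction j) (simp_all add: freshmans_dream prime_gt_0_nat)
    with j show "y ^ CHAR('a) = y" by simp
  qed (use prime_gt_1_nat[OF p] inj in \<open>auto simp: card_image\<close>)
  then show ?thesis using inj by (auto simp: inj_on_def)
qed

lemma zeta_pow_of_nat:
  "zeta_pow CHAR('a) (of_nat j :: 'a::{field,finite}) = zeta CHAR('a) ^ j"
proof -
  let ?p = "CHAR('a)"
  have p: "?p > 0" using prime_CHAR_finite_field prime_gt_0_nat by blast
  have "(THE i. i < ?p \<and> of_nat i = (of_nat j :: 'a)) = j mod ?p"
    by (rule the_equality) (use p in \<open>auto simp: of_nat_eq_iff_cong_CHAR cong_def\<close>)
  moreover have "zeta ?p ^ j = zeta ?p ^ (?p * (j div ?p) + j mod ?p)" by simp
  then have "zeta ?p ^ j = zeta ?p ^ (j mod ?p)"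
    using p by (simp only: power_add power_mult) simp
  ultimately show ?thesis by (simp add: zeta_pow_def)
qed

text \<open>The hypotheses place \<open>x\<close> and \<open>y\<close> in the prime field, where
  \<open>zeta_pow\<close> has its intended meaning.\<close>

lemma zeta_pow_add:
  fixes x y :: "'a::{field,finite}"
  assumes "x ^ CHAR('a) = x" "y ^ CHAR('a) = y"
  shows "zeta_pow CHAR('a) (x + y) = zeta_pow CHAR('a) x * zeta_pow CHAR('a) y"
proof -
  obtain i j where "x = of_nat i" "y = of_nat j"
    using prime_field_unique_of_nat[OF assms(1)] prime_field_unique_of_nat[OF assms(2)] by metis
  then show ?thesis
    by (simp add: zeta_pow_of_nat power_add flip: of_nat_add)
qed

lemma zeta_pow_neq_1:
  fixes x :: "'a::{field,finite}"
  assumes "x ^ CHAR('a) = x" "x \<noteq> 0"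
  shows "zeta_pow CHAR('a) x \<noteq> 1"
proof -
  obtain j where j: "x = of_nat j" "j < CHAR('a)"
    using prime_field_unique_of_nat[OF assms(1)] by metis
  with assms(2) have "\<not> CHAR('a) dvd j" by (auto simp: of_nat_eq_0_iff_char_dvd)
  with j show ?thesis by (simp add: zeta_pow_of_nat zeta_power_eq_1_iff)
qed

text \<open>Translation by \<open>a\<close> permutes \<open>S\<close> and multiplies the sum by
  \<open>\<psi> a\<close>, which is not 1.\<close>

lemma sum_character_eq_0:
  fixes \<psi> :: "'b::ab_group_add \<Rightarrow> complex"
  assumes "\<And>x y. x \<in> S \<Longrightarrow> y \<in> S \<Longrightarrow> x + y \<in> S \<and> - x \<in> S"
    and "\<And>x y. x \<in> S \<Longrightarrow> y \<in> S \<Longrightarrow> \<psi> (x + y) = \<psi> x * \<psi> y"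
    and "a \<in> S" "\<psi> a \<noteq> 1"
  shows "(\<Sum>x\<in>S. \<psi> x) = 0"
proof -
  have "(\<Sum>x\<in>S. \<psi> x) = (\<Sum>x\<in>S. \<psi> (a + x))"
    by (rule sum.reindex_bij_witness[of _ "\<lambda>x. a + x" "\<lambda>x. - a + x"])
      (use assms(1) assms(1)[OF assms(3)] assms(3) in \<open>auto simp del: add_uminus_conv_diff uminus_add_conv_diff\<close>)
  also have "\<dots> = \<psi> a * (\<Sum>x\<in>S. \<psi> x)"
    using assms(2,3) by (simp add: sum_distrib_left)
  finally show ?thesis using assms(4) by simp
qed

section \<open>Traces and evaluation\<close>

locale finite_field_extension =
  fixes emb :: "'k::{field,finite} \<Rightarrow> 'a::{field,finite}"
  assumes embedding: "field_embedding emb"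
begin

lemma emb_add: "emb (x + y) = emb x + emb y"
  and emb_mult: "emb (x * y) = emb x * emb y"
  and emb_1: "emb 1 = 1"
  using embedding by (auto simp: field_embedding_def)

lemma emb_0: "emb 0 = 0"
  using emb_add[of 0 0] by (metis add_cancel_right_right)

lemma emb_minus: "emb (- x) = - emb x"
  using emb_add[of x "- x"] emb_0 by (simp add: eq_neg_iff_add_eq_0 add.commute)

lemma emb_power: "emb (x ^ n) = emb x ^ n"
  by (induction n) (simp_all add: emb_1 emb_mult)

lemma emb_of_nat: "emb (of_nat n) = of_nat n"
  by (induction n) (simp_all add: emb_0 emb_1 emb_add)

lemma emb_eq_0_iff: "emb x = 0 \<longleftrightarrow> x = 0"
proof
  assume "emb x = 0"
  then have "emb (x * inverse x) = 0" by (simp add: emb_mult)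
  then show "x = 0" using emb_1 by (cases "x = 0") auto
qed (simp add: emb_0)

lemma inj_emb: "inj emb"
proof (rule injI)
  fix x y assume "emb x = emb y"
  then have "emb (x + - y) = 0" by (simp only: emb_add emb_minus) simp
  then show "x = y" by (simp only: emb_eq_0_iff) simp
qed

lemmas emb_simps = emb_add emb_mult emb_1 emb_0 emb_minus emb_power emb_eq_0_iff

text \<open>\<open>emb\<close> preserves the multiples of 1 and sends only 0 to 0, so the same
  multiples vanish in both fields.\<close>

lemma CHAR_emb: "CHAR('k) = CHAR('a)"
proof (rule dvd_antisym)
  show "CHAR('k) dvd CHAR('a)"
    by (metis emb_eq_0_iff emb_of_nat of_nat_CHAR of_nat_eq_0_iff_char_dvd)
  show "CHAR('a) dvd CHAR('k)"
    by (metis emb_0 emb_of_nat of_nat_CHAR of_nat_eq_0_iff_char_dvd)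
qed

lemma card_range_emb: "card (range emb) = CARD('k)"
  by (simp add: card_image inj_emb)

lemma emb_power_card: "emb a ^ (CARD('k) ^ t) = emb a"
proof -
  have "a ^ CARD('k) = a"
    using subfield_power_card(1)[of UNIV a] by (simp add: is_subfield_def)
  then have "a ^ (CARD('k) ^ t) = a"
    by (induction t) (simp_all add: power_mult)
  then show ?thesis by (simp flip: emb_power)
qed

lemma range_emb_iff: "y \<in> range emb \<longleftrightarrow> y ^ CARD('k) = y"
proof
  assume "y ^ CARD('k) = y"
  show "y \<in> range emb"
    by (rule mem_of_power_eq_self[OF _ _ CARD_field_gt_1[where 'k = 'k] _ \<open>y ^ CARD('k) = y\<close>])
      (use emb_power_card[of _ 1] in \<open>auto simp: card_range_emb\<close>)
qed (use emb_power_card[of _ 1] in auto)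

lemma subfield_range_emb: "is_subfield (range emb)"
proof -
  have "inverse (emb x) = emb (inverse x)" for x
    using emb_mult[of x "inverse x"] by (cases "x = 0") (auto simp: emb_0 emb_1 inverse_unique)
  then show ?thesis
    unfolding is_subfield_def
    by (auto simp flip: emb_add emb_mult emb_minus emb_0 emb_1)
qed

lemma subfield_adjoin: "is_subfield (adjoin emb \<alpha>)"
proof -
  have "is_subfield (\<Inter> T)" if "\<And>s. s \<in> T \<Longrightarrow> is_subfield s" for T :: "'a set set"
    using that unfolding is_subfield_def by blast
  then show ?thesis unfolding adjoin_def by (rule hull_in) blast
qed

lemma adjoin_superset: "\<alpha> \<in> adjoin emb \<alpha>" "range emb \<subseteq> adjoin emb \<alpha>"
  using hull_subset[of "insert \<alpha> (range emb)" is_subfield] by (auto simp: adjoin_def)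

section \<open>Polynomial evaluation and minimal polynomials\<close>

definition eval :: "'a \<Rightarrow> 'k poly \<Rightarrow> 'a" where
  "eval \<alpha> f = poly (map_poly emb f) \<alpha>"

lemma eval_pCons: "eval \<alpha> (pCons a f) = emb a + \<alpha> * eval \<alpha> f"
  by (simp add: eval_def map_poly_pCons emb_0)

lemma eval_0: "eval \<alpha> 0 = 0"
  by (simp add: eval_def)

lemma eval_add: "eval \<alpha> (f + g) = eval \<alpha> f + eval \<alpha> g"
proof (induction f arbitrary: g)
  case (pCons a f)
  then show ?case by (cases g) (simp add: eval_pCons emb_add algebra_simps)
qed (simp add: eval_0)

lemma eval_smult: "eval \<alpha> (smult c f) = emb c * eval \<alpha> f"
  by (induction f) (simp_all add: eval_pCons eval_0 emb_mult algebra_simps)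

lemma eval_mult: "eval \<alpha> (f * g) = eval \<alpha> f * eval \<alpha> g"
  by (induction f) (simp_all add: eval_pCons eval_0 eval_add eval_smult emb_0 algebra_simps)

lemma eval_power: "eval \<alpha> (f ^ n) = eval \<alpha> f ^ n"
  by (induction n) (simp_all add: eval_mult eval_pCons eval_0 emb_1 one_pCons)

lemma eval_monom: "eval \<alpha> (monom c n) = emb c * \<alpha> ^ n"
  by (simp add: eval_def map_poly_monom emb_0 poly_monom)

text \<open>The polynomial values at \<alpha> form a subfield containing \<alpha> and the base
  field; finiteness supplies the inverses.\<close>

lemma adjoin_subset_range_eval: "adjoin emb \<alpha> \<subseteq> range (eval \<alpha>)"
  unfolding adjoin_def
proof (rule hull_minimal)
  have const: "emb a = eval \<alpha> [:a:]" for a by (simp add: eval_pCons eval_0)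
  have "\<alpha> = eval \<alpha> [:0, 1:]" by (simp add: eval_pCons eval_0 emb_1 emb_0)
  then show "insert \<alpha> (range emb) \<subseteq> range (eval \<alpha>)" using const by (auto intro: range_eqI)
  have neg: "- eval \<alpha> f = eval \<alpha> (smult (- 1) f)" for f
    by (simp only: eval_smult emb_minus emb_1) simp
  \<comment> \<open>A nonzero \<open>y\<close> has \<open>inverse y = y ^ (CARD('a) - 2)\<close>,
    again a polynomial value; for zero, \<open>inverse 0 = 0\<close>.\<close>
  have inv: "inverse (eval \<alpha> f) \<in> range (eval \<alpha>)" for f
  proof (cases "eval \<alpha> f = 0")
    case True
    then show ?thesis by (auto intro: range_eqI[of _ _ 0] simp: eval_0)
  next
    case False
    have "eval \<alpha> f ^ (CARD('a) - 1) = 1"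
      using False subfield_power_card(2)[of UNIV "eval \<alpha> f"] by (simp add: is_subfield_def)
    moreover have "CARD('a) - 1 = Suc (CARD('a) - 2)"
      using CARD_field_gt_1[where 'k = 'a] by simp
    ultimately have "inverse (eval \<alpha> f) = eval \<alpha> (f ^ (CARD('a) - 2))"
      by (simp add: eval_power inverse_unique)
    then show ?thesis by simp
  qed
  show "is_subfield (range (eval \<alpha>))"
    unfolding is_subfield_def
    using const[of 0] const[of 1]
    by (auto simp: emb_0 emb_1 neg inv simp flip: eval_add eval_mult intro: range_eqI)
qed

text \<open>Take a nonzero polynomial of least degree vanishing at \<alpha>: in a factorization one
  factor vanishes at \<alpha>, and minimality makes the other constant.\<close>

lemma minimal_polynomial:
  obtains f where "irreducible f" "eval \<alpha> f = 0"
proof -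
  let ?N = "CARD('a)"
  let ?P = "\<lambda>f. f \<noteq> 0 \<and> eval \<alpha> f = 0"
  have N: "?N > 1" by (rule CARD_field_gt_1)
  \<comment> \<open>This is \<open>X ^ ?N - X\<close>, which vanishes at every element of the
    extension, so there is a candidate for the least degree.\<close>
  let ?g = "monom 1 ?N + monom (- 1) 1 :: 'k poly"
  have "\<alpha> ^ ?N = \<alpha>"
    using subfield_power_card(1)[of UNIV \<alpha>] by (simp add: is_subfield_def)
  then have "eval \<alpha> ?g = 0" by (simp add: eval_add eval_monom emb_simps)
  moreover have "coeff ?g ?N = 1" using N by simp
  then have "?g \<noteq> 0" by (metis coeff_0 zero_neq_one)
  ultimately have "?P ?g" by blast
  from ex_has_least_nat[of ?P, OF this, of degree]
  obtain f where f: "f \<noteq> 0" "eval \<alpha> f = 0" and least: "\<And>g. ?P g \<Longrightarrow> degree f \<le> degree g"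
    by blast
  have "irreducible f"
  proof (rule irreducibleI)
    show "\<not> is_unit f"
    proof
      assume "is_unit f"
      then obtain c where "f = [:c:]" using f(1) by (auto simp: is_unit_iff_degree elim: degree_eq_zeroE)
      with f show False by (simp add: eval_pCons eval_0 emb_eq_0_iff)
    qed
    fix a b assume ab: "f = a * b"
    then have nz: "a \<noteq> 0" "b \<noteq> 0" using f(1) by auto
    have "eval \<alpha> a = 0 \<or> eval \<alpha> b = 0" using f(2) ab by (simp add: eval_mult)
    then show "is_unit a \<or> is_unit b"
      using least[of a] least[of b] nz ab by (auto simp: is_unit_iff_degree degree_mult_eq)
  qed (use f in simp)
  with f(2) show thesis using that by blast
qed

lemma conjugate_overI:
  "irreducible f \<Longrightarrow> eval x f = 0 \<Longrightarrow> eval y f = 0 \<Longrightarrow> conjugate_over emb x y"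
  by (auto simp: conjugate_over_def eval_def)

section \<open>The trace to the base field\<close>

lemma CARD_eq_power:
  obtains s where "CARD('k) = CHAR('a) ^ s" "s > 0"
  using CARD_eq_power_CHAR[where 'k = 'k] CHAR_emb by metis

text \<open>The trace is fixed by the \<open>CARD('k)\<close>-th power map, whose fixed points are
  the embedded base field.\<close>

lemma field_trace_in_range:
  assumes "is_subfield L" "card L = CARD('k) ^ k" "x \<in> L"
  shows "field_trace CARD('k) L x \<in> range emb"
proof -
  obtain s where "CARD('k) = CHAR('a) ^ s" using CARD_eq_power by blast
  from field_trace_power[OF this CARD_field_gt_1 assms(2,1,3)] show ?thesis
    by (simp add: range_emb_iff)
qed

text \<open>On traces the \<open>inv emb\<close> in \<open>base_trace\<close> is a true inverse, so
  identities for \<open>base_trace\<close> can be checked after applying \<open>emb\<close>.\<close>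

lemma emb_base_trace:
  assumes "is_subfield L" "card L = CARD('k) ^ k" "x \<in> L"
  shows "emb (base_trace emb L x) = field_trace CARD('k) L x"
  unfolding base_trace_def using field_trace_in_range[OF assms] by (simp add: f_inv_into_f)

lemma base_trace_add:
  assumes L: "is_subfield L" "card L = CARD('k) ^ k" and xy: "x \<in> L" "y \<in> L"
  shows "base_trace emb L (x + y) = base_trace emb L x + base_trace emb L y"
proof -
  have "x + y \<in> L" using L(1) xy by (simp add: is_subfield_def)
  moreover obtain s where "CARD('k) = CHAR('a) ^ s" using CARD_eq_power by blast
  ultimately have "emb (base_trace emb L (x + y)) = emb (base_trace emb L x + base_trace emb L y)"
    using xy by (simp add: emb_base_trace[OF L] emb_add field_trace_add)
  then show ?thesis using inj_emb by (simp add: inj_eq)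
qed

lemma base_trace_scale:
  assumes L: "is_subfield L" "card L = CARD('k) ^ k" "range emb \<subseteq> L" and x: "x \<in> L"
  shows "base_trace emb L (emb a * x) = a * base_trace emb L x"
proof -
  have "emb a * x \<in> L" using L(1,3) x by (auto simp: is_subfield_def)
  moreover have "field_trace CARD('k) L (emb a * x) = emb a * field_trace CARD('k) L x"
    by (simp add: field_trace_def power_mult_distrib emb_power_card sum_distrib_left)
  ultimately have "emb (base_trace emb L (emb a * x)) = emb (a * base_trace emb L x)"
    using x by (simp add: emb_base_trace[OF L(1,2)] emb_mult)
  then show ?thesis using inj_emb by (simp add: inj_eq)
qed

lemma base_trace_0:
  assumes "is_subfield L" "card L = CARD('k) ^ k"
  shows "base_trace emb L 0 = 0"
  using base_trace_add[OF assms, of 0 0] assms(1) by (metis add_cancel_right_right is_subfield_def)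

text \<open>For \<open>b \<noteq> 0\<close> the products \<open>b * y\<close> cover
  \<open>L\<close>, so the trace would vanish identically.\<close>

lemma base_trace_nondegenerate:
  assumes L: "is_subfield L" "card L = CARD('k) ^ k" and b: "b \<in> L"
    and zero: "\<And>y. y \<in> L \<Longrightarrow> base_trace emb L (b * y) = 0"
  shows "b = 0"
proof (rule ccontr)
  assume "b \<noteq> 0"
  have "{0, 1} \<subseteq> L" using L(1) by (simp add: is_subfield_def)
  from card_mono[OF _ this] have "card L \<noteq> 1" by simp
  then have "k > 0" using L(2) by (cases k) auto
  then obtain x where x: "x \<in> L" "field_trace CARD('k) L x \<noteq> 0"
    using field_trace_not_all_zero[OF L(2) CARD_field_gt_1] by blast
  have "inverse b * x \<in> L" using L(1) b x(1) by (simp add: is_subfield_def)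
  from zero[OF this] have "emb (base_trace emb L x) = 0"
    using \<open>b \<noteq> 0\<close> by (simp add: emb_0 flip: mult.assoc)
  with x show False by (simp add: emb_base_trace[OF L])
qed

section \<open>The canonical additive character\<close>

text \<open>The absolute trace of the base field, computed on the copy \<open>range emb\<close> so
  that its values have the same type as the absolute traces of the intermediate fields.\<close>

definition prime_trace :: "'k \<Rightarrow> 'a" where
  "prime_trace a = field_trace CHAR('a) (range emb) (emb a)"

lemma prime_trace_add: "prime_trace (a + b) = prime_trace a + prime_trace b"
  by (simp add: prime_trace_def emb_add field_trace_add[where s = 1])

lemma prime_trace_power: "prime_trace a ^ CHAR('a) = prime_trace a"
proof -
  obtain s where s: "CARD('k) = CHAR('a) ^ s" using CARD_eq_power by blast
  show ?thesis
    unfolding prime_trace_def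
    by (rule field_trace_power[where s = 1 and k = s])
      (use s subfield_range_emb prime_gt_1_nat[OF prime_CHAR_finite_field[where 'k = 'a]]
        in \<open>auto simp: card_range_emb\<close>)
qed

text \<open>With \<open>CARD('k) = CHAR('a) ^ s\<close>, every \<open>i < k * s\<close> is uniquely
  \<open>t * s + u\<close> with \<open>t < k\<close> and \<open>u < s\<close>, which splits the sum
  of conjugates into two nested traces.\<close>

lemma field_trace_transitive:
  assumes L: "is_subfield L" "card L = CARD('k) ^ k" and x: "x \<in> L"
  shows "field_trace CHAR('a) L x = prime_trace (base_trace emb L x)"
proof -
  let ?p = "CHAR('a)"
  have p: "?p > 1" using prime_gt_1_nat[OF prime_CHAR_finite_field[where 'k = 'a]] .
  obtain s where s: "CARD('k) = ?p ^ s" using CARD_eq_power by blast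
  have cardL: "card L = ?p ^ (k * s)"
    using L(2) s by (simp add: mult.commute flip: power_mult)
  have "prime_trace (base_trace emb L x) = (\<Sum>u<s. (\<Sum>t<k. x ^ (CARD('k) ^ t)) ^ (?p ^ u))"
    unfolding prime_trace_def field_trace_eq[OF card_range_emb[unfolded s] p]
      emb_base_trace[OF L x] field_trace_eq[OF L(2) CARD_field_gt_1] ..
  also have "\<dots> = (\<Sum>u<s. \<Sum>t<k. x ^ (?p ^ (t * s + u)))"
    using power_CHAR_additive(2)[where 'a = 'a and r = ?p and s = 1 and I = "{..<k}"]
    by (simp add: s power_add power_mult mult.commute[of _ s])
  also have "\<dots> = (\<Sum>t<k. \<Sum>u<s. x ^ (?p ^ (t * s + u)))"
    by (rule sum.swap)
  also have "\<dots> = (\<Sum>i<k * s. x ^ (?p ^ i))"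
    by (rule sum_lessThan_mult[symmetric])
  finally show ?thesis by (simp add: field_trace_eq[OF cardL p])
qed

definition add_char :: "'k \<Rightarrow> complex" where
  "add_char a = zeta_pow CHAR('a) (prime_trace a)"

lemma add_char_add: "add_char (a + b) = add_char a * add_char b"
  by (simp add: add_char_def prime_trace_add zeta_pow_add prime_trace_power)

lemma add_char_0: "add_char 0 = 1"
proof -
  have "prime_trace 0 = of_nat 0" using prime_trace_add[of 0 0]
    by (metis add_cancel_right_right of_nat_0)
  then show ?thesis unfolding add_char_def by (simp only: zeta_pow_of_nat) simp
qed

text \<open>The absolute trace is not identically zero, and \<open>zeta_pow\<close> differs from 1
  at nonzero elements of the prime field.\<close>

lemma add_char_nontrivial: obtains a where "add_char a \<noteq> 1"
proof -
  obtain s where s: "CARD('k) = CHAR('a) ^ s" "s > 0" using CARD_eq_power by blast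
  then obtain a where "prime_trace a \<noteq> 0"
    using field_trace_not_all_zero[of "range emb" "CHAR('a)" s]
      prime_gt_1_nat[OF prime_CHAR_finite_field[where 'k = 'a]]
    by (auto simp: card_range_emb prime_trace_def)
  then have "add_char a \<noteq> 1"
    unfolding add_char_def by (intro zeta_pow_neq_1 prime_trace_power)
  then show thesis using that by blast
qed

end

section \<open>Gauss sums\<close>

text \<open>Exponents reduce modulo \<open>card L - 1\<close>, so that many powers already cover
  \<open>L - {0}\<close>; equal cardinalities then give injectivity.\<close>

lemma primitive_element_bij:
  assumes "is_subfield L" "finite L" "primitive_element L \<gamma>"
  shows "bij_betw (\<lambda>i. \<gamma> ^ i) {..<card L - 1} (L - {0})"
proof -
  let ?N = "card L - 1"
  have range: "L - {0} = range (\<lambda>i::nat. \<gamma> ^ i)"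
    using assms(3) by (simp add: primitive_element_def)
  then have g: "\<gamma> \<in> L" "\<gamma> \<noteq> 0" using rangeI[of "\<lambda>i. \<gamma> ^ i" 1] by auto
  then have one: "\<gamma> ^ ?N = 1" using subfield_power_card(2)[OF assms(1,2)] by blast
  have "{0, 1} \<subseteq> L" using assms(1) by (simp add: is_subfield_def)
  from card_mono[OF assms(2) this] have N: "?N > 0" by simp
  have "(\<lambda>i. \<gamma> ^ i) ` {..<?N} = L - {0}"
  proof (intro equalityI subsetI)
    fix x assume "x \<in> L - {0}"
    then obtain i where "x = \<gamma> ^ i" using range by blast
    also have "\<dots> = \<gamma> ^ (?N * (i div ?N) + i mod ?N)" by simp
    also have "\<dots> = \<gamma> ^ (i mod ?N)" by (simp only: power_add power_mult one) simp
    finally show "x \<in> (\<lambda>i. \<gamma> ^ i) ` {..<?N}" using N by auto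
  qed (use range in auto)
  moreover have "card (L - {0}) = ?N"
    using assms(1,2) by (simp add: is_subfield_def card_Diff_singleton)
  ultimately show ?thesis
    unfolding bij_betw_def by (metis card_lessThan eq_card_imp_inj_on finite_lessThan)
qed

lemma mult_character_power:
  assumes "mult_character L \<chi>" "is_subfield L" "g \<in> L - {0}"
  shows "\<chi> 1 = 1" "\<chi> (g ^ i) = \<chi> g ^ i"
proof -
  have "1 \<in> L - {0}" using assms(2) by (simp add: is_subfield_def)
  then have "\<chi> (1 * 1) = \<chi> 1 * \<chi> 1" "\<chi> 1 \<noteq> 0" using assms(1) unfolding mult_character_def by blast+
  then show one: "\<chi> 1 = 1" by simp
  have pow: "g ^ i \<in> L - {0}" for i
    by (induction i) (use assms(2,3) in \<open>auto simp: is_subfield_def\<close>)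
  show "\<chi> (g ^ i) = \<chi> g ^ i"
  proof (induction i)
    case (Suc i)
    then show ?case using assms(1,3) pow[of i] by (simp add: mult_character_def)
  qed (simp add: one)
qed

text \<open>
  Fourier inversion on the quotient of the multiplicative group of \<open>L\<close> by the subgroup of
  \<open>e\<close>-th powers, whose character group consists of the powers of \<open>\<chi>\<close>.
\<close>

lemma sum_character_powers:
  fixes f :: "'a::field \<Rightarrow> complex"
  assumes L: "is_subfield L" "finite L" and \<gamma>: "primitive_element L \<gamma>" and em: "card L - 1 = e * m"
    and \<chi>: "mult_character L \<chi>" "\<chi> \<gamma> = zeta e" and \<beta>: "\<beta> \<in> L - {0}"
  shows "(\<Sum>l<e. (\<Sum>x\<in>L - {0}. \<chi> x ^ l * f x) * cnj (\<chi> \<beta>) ^ l)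
    = of_nat e * (\<Sum>t<m. f (\<beta> * (\<gamma> ^ e) ^ t))"
proof -
  note bij = primitive_element_bij[OF L \<gamma>, unfolded em]
  have mult: "x * y \<in> L - {0}" "\<chi> (x * y) = \<chi> x * \<chi> y" if "x \<in> L - {0}" "y \<in> L - {0}" for x y
    using that \<chi>(1) L(1) by (auto simp: mult_character_def is_subfield_def)
  have "{0, 1} \<subseteq> L" using L(1) by (simp add: is_subfield_def)
  from card_mono[OF L(2) this] have em0: "e > 0" "m > 0" using em by (cases e; cases m; simp)+
  have g: "\<gamma> \<in> L - {0}"
    using rangeI[of "\<lambda>i. \<gamma> ^ i" 1] \<gamma> by (auto simp: primitive_element_def)
  have \<chi>_pow: "\<chi> (\<gamma> ^ i) = zeta e ^ i" for i
    using mult_character_power(2)[OF \<chi>(1) L(1) g] \<chi>(2) by simp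
  obtain b where "\<beta> = \<gamma> ^ b" using \<beta> \<gamma> by (auto simp: primitive_element_def)
  \<comment> \<open>\<open>\<chi> \<beta>\<close> is a power of \<open>zeta e\<close>, so
    conjugation inverts it.\<close>
  then have "norm (\<chi> \<beta>) = 1" by (simp add: \<chi>_pow norm_power)
  then have unit: "cnj (\<chi> \<beta>) * \<chi> \<beta> = 1"
    by (simp add: complex_norm_square[symmetric] mult.commute)
  have "(\<Sum>l<e. (\<Sum>x\<in>L - {0}. \<chi> x ^ l * f x) * cnj (\<chi> \<beta>) ^ l)
    = (\<Sum>l<e. \<Sum>x\<in>L - {0}. f x * (cnj (\<chi> \<beta>) * \<chi> x) ^ l)"
    by (simp add: sum_distrib_left power_mult_distrib mult_ac)
  also have "\<dots> = (\<Sum>x\<in>L - {0}. \<Sum>l<e. f x * (cnj (\<chi> \<beta>) * \<chi> x) ^ l)"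
    by (rule sum.swap)
  \<comment> \<open>Substituting \<open>x = \<beta> * y\<close> absorbs the factor
    \<open>cnj (\<chi> \<beta>)\<close>.\<close>
  also have "\<dots> = (\<Sum>y\<in>L - {0}. \<Sum>l<e. f (\<beta> * y) * \<chi> y ^ l)"
  proof (rule sum.reindex_bij_witness[of _ "\<lambda>y. \<beta> * y" "\<lambda>x. inverse \<beta> * x"])
    fix x assume x: "x \<in> L - {0}"
    show "inverse \<beta> * x \<in> L - {0}"
      using mult(1)[of "inverse \<beta>" x] x \<beta> L(1) by (auto simp: is_subfield_def)
    then have "\<chi> x = \<chi> \<beta> * \<chi> (inverse \<beta> * x)"
      using mult(2)[OF \<beta>, of "inverse \<beta> * x"] \<beta> by (simp flip: mult.assoc)
    then have "cnj (\<chi> \<beta>) * \<chi> x = \<chi> (inverse \<beta> * x)"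
      using unit by (simp flip: mult.assoc)
    then show "(\<Sum>l<e. f (\<beta> * (inverse \<beta> * x)) * \<chi> (inverse \<beta> * x) ^ l)
      = (\<Sum>l<e. f x * (cnj (\<chi> \<beta>) * \<chi> x) ^ l)"
      using \<beta> by (simp flip: mult.assoc)
  qed (use mult(1)[OF \<beta>] \<beta> in \<open>auto simp flip: mult.assoc\<close>)
  also have "\<dots> = (\<Sum>i<e * m. \<Sum>l<e. f (\<beta> * \<gamma> ^ i) * \<chi> (\<gamma> ^ i) ^ l)"
    by (rule sum.reindex_bij_betw[OF bij, symmetric])
  \<comment> \<open>Orthogonality over \<open>l\<close> keeps only the exponents divisible by
    \<open>e\<close>.\<close>
  also have "\<dots> = (\<Sum>i<e * m. if e dvd i then of_nat e * f (\<beta> * \<gamma> ^ i) else 0)"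
  proof (rule sum.cong[OF refl])
    fix i
    have "(\<Sum>l<e. f (\<beta> * \<gamma> ^ i) * \<chi> (\<gamma> ^ i) ^ l) = f (\<beta> * \<gamma> ^ i) * (\<Sum>l<e. zeta e ^ (i * l))"
      by (simp add: \<chi>_pow sum_distrib_left power_mult)
    then show "(\<Sum>l<e. f (\<beta> * \<gamma> ^ i) * \<chi> (\<gamma> ^ i) ^ l)
      = (if e dvd i then of_nat e * f (\<beta> * \<gamma> ^ i) else 0)"
      by (simp add: sum_zeta_powers[OF em0(1)])
  qed
  also have "\<dots> = (\<Sum>i | i < e * m \<and> e dvd i. of_nat e * f (\<beta> * \<gamma> ^ i))"
    by (rule sum.mono_neutral_cong_right) auto
  also have "\<dots> = (\<Sum>t<m. of_nat e * f (\<beta> * (\<gamma> ^ e) ^ t))"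
    by (rule sum.reindex_bij_witness[of _ "\<lambda>t. e * t" "\<lambda>i. i div e"])
      (use em0 in \<open>auto simp: dvd_mult_div_cancel less_mult_imp_div_less mult.commute[of e m] simp flip: power_mult\<close>)
  finally show ?thesis by (simp add: sum_distrib_left)
qed

section \<open>The pair of cyclic codes\<close>

text \<open>Here \<open>n\<close> is any common period of the two sequences of powers; the theorem
  takes the least common multiple of the orders.\<close>

locale cyclic_code_pair = finite_field_extension emb
  for emb :: "'k::{field,finite} \<Rightarrow> 'a::{field,finite}" +
  fixes \<alpha>\<^sub>1 \<alpha>\<^sub>2 :: 'a and F\<^sub>1 F\<^sub>2 :: "'a set" and k\<^sub>1 k\<^sub>2 n :: nat
  assumes F: "F\<^sub>1 = adjoin emb \<alpha>\<^sub>1" "F\<^sub>2 = adjoin emb \<alpha>\<^sub>2"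
    and card_F: "card F\<^sub>1 = CARD('k) ^ k\<^sub>1" "card F\<^sub>2 = CARD('k) ^ k\<^sub>2"
    and not_conj: "\<not> conjugate_over emb \<alpha>\<^sub>1 \<alpha>\<^sub>2"
    and n_pos: "n > 0" and power_n: "\<alpha>\<^sub>1 ^ n = 1" "\<alpha>\<^sub>2 ^ n = 1"
begin

sublocale P: vector_space "pair_scale emb"
  by (rule vector_space_pair_scale[OF embedding])

sublocale W: vector_space "word_scale :: 'k \<Rightarrow> _"
  by (rule vector_space_word_scale)

abbreviation T\<^sub>1 :: "'a \<Rightarrow> 'k" where "T\<^sub>1 \<equiv> base_trace emb F\<^sub>1"
abbreviation T\<^sub>2 :: "'a \<Rightarrow> 'k" where "T\<^sub>2 \<equiv> base_trace emb F\<^sub>2"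

text \<open>With the parameters packed into a pair, both codes are images of subspaces under one
  linear map.\<close>

definition word :: "'a \<times> 'a \<Rightarrow> nat \<Rightarrow> 'k" where
  "word x = cyclic_word emb n F\<^sub>1 \<alpha>\<^sub>1 F\<^sub>2 \<alpha>\<^sub>2 (fst x) (snd x)"

lemma subfields: "is_subfield F\<^sub>1" "is_subfield F\<^sub>2"
  by (simp_all add: F subfield_adjoin)

lemma F_closed:
  "0 \<in> F\<^sub>1" "x \<in> F\<^sub>1 \<Longrightarrow> y \<in> F\<^sub>1 \<Longrightarrow> x + y \<in> F\<^sub>1" "x \<in> F\<^sub>1 \<Longrightarrow> y \<in> F\<^sub>1 \<Longrightarrow> x * y \<in> F\<^sub>1" "emb a \<in> F\<^sub>1"
  "0 \<in> F\<^sub>2" "x \<in> F\<^sub>2 \<Longrightarrow> y \<in> F\<^sub>2 \<Longrightarrow> x + y \<in> F\<^sub>2" "x \<in> F\<^sub>2 \<Longrightarrow> y \<in> F\<^sub>2 \<Longrightarrow> x * y \<in> F\<^sub>2" "emb a \<in> F\<^sub>2"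
  using subfields adjoin_superset(2) by (auto simp: is_subfield_def F)

lemma alpha_power: "\<alpha>\<^sub>1 ^ i \<in> F\<^sub>1" "\<alpha>\<^sub>2 ^ i \<in> F\<^sub>2"
proof -
  have "\<alpha>\<^sub>1 \<in> F\<^sub>1" "\<alpha>\<^sub>2 \<in> F\<^sub>2" "1 \<in> F\<^sub>1" "1 \<in> F\<^sub>2"
    using subfields adjoin_superset(1) by (auto simp: is_subfield_def F)
  then show "\<alpha>\<^sub>1 ^ i \<in> F\<^sub>1" "\<alpha>\<^sub>2 ^ i \<in> F\<^sub>2" by (induction i) (auto intro: F_closed)
qed

lemmas trace_add = base_trace_add[OF subfields(1) card_F(1)] base_trace_add[OF subfields(2) card_F(2)]
lemmas trace_0 = base_trace_0[OF subfields(1) card_F(1)] base_trace_0[OF subfields(2) card_F(2)]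

lemma trace_scale:
  "x \<in> F\<^sub>1 \<Longrightarrow> T\<^sub>1 (emb a * x) = a * T\<^sub>1 x" "x \<in> F\<^sub>2 \<Longrightarrow> T\<^sub>2 (emb a * x) = a * T\<^sub>2 x"
  using base_trace_scale[OF subfields(1) card_F(1)] base_trace_scale[OF subfields(2) card_F(2)]
  by (simp_all add: image_subset_iff F_closed)

lemma word_nth: "word x i = (if i < n then T\<^sub>1 (fst x * \<alpha>\<^sub>1 ^ i) + T\<^sub>2 (snd x * \<alpha>\<^sub>2 ^ i) else 0)"
  by (simp add: word_def cyclic_word_def)

lemma word_add:
  assumes "x \<in> F\<^sub>1 \<times> F\<^sub>2" "y \<in> F\<^sub>1 \<times> F\<^sub>2"
  shows "word (x + y) = word x + word y"
  using assms by (auto simp: fun_eq_iff word_nth distrib_right trace_add F_closed alpha_power)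

lemma word_pair_scale:
  assumes "x \<in> F\<^sub>1 \<times> F\<^sub>2"
  shows "word (pair_scale emb a x) = word_scale a (word x)"
  using assms
  by (auto simp: fun_eq_iff word_nth pair_scale_def word_scale_def mult.assoc trace_scale
      F_closed alpha_power distrib_left)

lemma word_0: "word 0 = 0"
  by (simp add: fun_eq_iff word_nth trace_0)

lemma subspace_pairs: "P.subspace (F\<^sub>1 \<times> F\<^sub>2)"
  by (auto simp: P.subspace_def pair_scale_def F_closed zero_prod_def)

text \<open>Linearity extends the vanishing of the entries to a trace relation for the values of
  every polynomial at both elements. Multiples of the minimal polynomial of
  \<open>\<alpha>\<^sub>2\<close> remove the second trace, yet their values at
  \<open>\<alpha>\<^sub>1\<close> fill \<open>F\<^sub>1\<close>; nondegeneracy gives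
  \<open>b\<^sub>1 = 0\<close>, and then \<open>b\<^sub>2 = 0\<close>.\<close>

lemma word_zero_imp_zero:
  assumes b: "b\<^sub>1 \<in> F\<^sub>1" "b\<^sub>2 \<in> F\<^sub>2" and zero: "word (b\<^sub>1, b\<^sub>2) = 0"
  shows "b\<^sub>1 = 0 \<and> b\<^sub>2 = 0"
proof -
  \<comment> \<open>Periodicity carries the relation from the \<open>n\<close> positions to all
    exponents.\<close>
  have "\<alpha>\<^sub>1 ^ i = \<alpha>\<^sub>1 ^ (n * (i div n) + i mod n)" "\<alpha>\<^sub>2 ^ i = \<alpha>\<^sub>2 ^ (n * (i div n) + i mod n)" for i
    by simp_all
  then have mod: "\<alpha>\<^sub>1 ^ i = \<alpha>\<^sub>1 ^ (i mod n)" "\<alpha>\<^sub>2 ^ i = \<alpha>\<^sub>2 ^ (i mod n)" for i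
    by (simp_all only: power_add power_mult power_n power_one mult_1)
  have base: "T\<^sub>1 (b\<^sub>1 * \<alpha>\<^sub>1 ^ i) + T\<^sub>2 (b\<^sub>2 * \<alpha>\<^sub>2 ^ i) = 0" for i
    using fun_cong[OF zero, of "i mod n"] n_pos by (simp add: word_nth mod[symmetric])
  have eval_in: "eval \<alpha>\<^sub>1 f \<in> F\<^sub>1" "eval \<alpha>\<^sub>2 f \<in> F\<^sub>2" for f
    using alpha_power[of 1] by (induction f) (auto simp: eval_0 eval_pCons intro: F_closed)
  \<comment> \<open>Peeling off the constant coefficient leaves one more power of the evaluation
    point, hence the arbitrary shift \<open>i\<close>.\<close>
  have all_shifts: "T\<^sub>1 (b\<^sub>1 * \<alpha>\<^sub>1 ^ i * eval \<alpha>\<^sub>1 f) + T\<^sub>2 (b\<^sub>2 * \<alpha>\<^sub>2 ^ i * eval \<alpha>\<^sub>2 f) = 0" for f i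
  proof (induction f arbitrary: i)
    case (pCons a f)
    have split: "b * x ^ i * (emb a + x * E) = emb a * (b * x ^ i) + b * x ^ Suc i * E" for b x E
      by (simp add: algebra_simps)
    have "T\<^sub>1 (b\<^sub>1 * \<alpha>\<^sub>1 ^ i * eval \<alpha>\<^sub>1 (pCons a f)) + T\<^sub>2 (b\<^sub>2 * \<alpha>\<^sub>2 ^ i * eval \<alpha>\<^sub>2 (pCons a f))
      = a * (T\<^sub>1 (b\<^sub>1 * \<alpha>\<^sub>1 ^ i) + T\<^sub>2 (b\<^sub>2 * \<alpha>\<^sub>2 ^ i))
        + (T\<^sub>1 (b\<^sub>1 * \<alpha>\<^sub>1 ^ Suc i * eval \<alpha>\<^sub>1 f) + T\<^sub>2 (b\<^sub>2 * \<alpha>\<^sub>2 ^ Suc i * eval \<alpha>\<^sub>2 f))"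
      unfolding eval_pCons split using b eval_in alpha_power alpha_power[of "Suc i"]
      by (simp add: trace_add trace_scale F_closed distrib_left del: power_Suc)
    also have "\<dots> = 0" unfolding base pCons.IH by simp
    finally show ?case .
  qed (simp add: eval_0 trace_0)
  have all: "T\<^sub>1 (b\<^sub>1 * eval \<alpha>\<^sub>1 f) + T\<^sub>2 (b\<^sub>2 * eval \<alpha>\<^sub>2 f) = 0" for f
    using all_shifts[of 0 f] by simp
  obtain \<mu> where \<mu>: "irreducible \<mu>" "eval \<alpha>\<^sub>2 \<mu> = 0" using minimal_polynomial by blast
  \<comment> \<open>A common zero of the irreducible \<open>\<mu>\<close> would make the two
    elements conjugate.\<close>
  then have nz: "eval \<alpha>\<^sub>1 \<mu> \<noteq> 0" using conjugate_overI not_conj by blast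
  have "b\<^sub>1 = 0"
  proof (rule base_trace_nondegenerate[OF subfields(1) card_F(1) b(1)])
    fix y assume "y \<in> F\<^sub>1"
    \<comment> \<open>Dividing first makes \<open>g * \<mu>\<close> take the value \<open>y\<close>
      at \<open>\<alpha>\<^sub>1\<close> and 0 at \<open>\<alpha>\<^sub>2\<close>.\<close>
    then have "y * inverse (eval \<alpha>\<^sub>1 \<mu>) \<in> F\<^sub>1"
      using eval_in(1)[of \<mu>] subfields(1) by (simp add: is_subfield_def)
    then obtain g where g: "y * inverse (eval \<alpha>\<^sub>1 \<mu>) = eval \<alpha>\<^sub>1 g"
      using adjoin_subset_range_eval[of \<alpha>\<^sub>1] F by blast
    have "y = eval \<alpha>\<^sub>1 (g * \<mu>)" using nz by (simp add: eval_mult g[symmetric])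
    then show "T\<^sub>1 (b\<^sub>1 * y) = 0" using all[of "g * \<mu>"] by (simp add: eval_mult \<mu>(2) trace_0)
  qed
  moreover have "b\<^sub>2 = 0"
  proof (rule base_trace_nondegenerate[OF subfields(2) card_F(2) b(2)])
    fix y assume "y \<in> F\<^sub>2"
    then obtain g where g: "y = eval \<alpha>\<^sub>2 g"
      using adjoin_subset_range_eval[of \<alpha>\<^sub>2] F by blast
    then show "T\<^sub>2 (b\<^sub>2 * y) = 0" using all[of g] \<open>b\<^sub>1 = 0\<close> by (simp add: trace_0)
  qed
  ultimately show ?thesis ..
qed

lemma inj_on_word: "inj_on word (F\<^sub>1 \<times> F\<^sub>2)"
proof (rule inj_onI)
  fix x y assume xy: "x \<in> F\<^sub>1 \<times> F\<^sub>2" "y \<in> F\<^sub>1 \<times> F\<^sub>2" and eq: "word x = word y"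
  have d: "x - y \<in> F\<^sub>1 \<times> F\<^sub>2" using xy by (intro P.subspace_diff[OF subspace_pairs])
  have "word x = word (x - y) + word y" using word_add[OF d xy(2)] by simp
  then have "word (x - y) = 0" using eq by simp
  then show "x = y"
    using word_zero_imp_zero[of "fst (x - y)" "snd (x - y)"] d by (auto simp: prod_eq_iff)
qed

text \<open>The dimensions agree by counting: \<open>word\<close> is injective on \<open>H\<close>,
  and both cardinalities are powers of \<open>CARD('k)\<close>.\<close>

lemma subspace_word_image:
  assumes "P.subspace H" "H \<subseteq> F\<^sub>1 \<times> F\<^sub>2"
  shows "W.subspace (word ` H)" "W.dim (word ` H) = P.dim H"
proof -
  show sub: "W.subspace (word ` H)"
    unfolding W.subspace_def
  proof (intro conjI ballI allI)
    show "0 \<in> word ` H" using P.subspace_0[OF assms(1)] word_0 by force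
  next
    fix v w assume "v \<in> word ` H" "w \<in> word ` H"
    then obtain x y where xy: "x \<in> H" "y \<in> H" "v = word x" "w = word y" by blast
    then have "v + w = word (x + y)" using word_add[of x y] assms(2) by (simp add: subset_eq)
    then show "v + w \<in> word ` H" using P.subspace_add[OF assms(1) xy(1,2)] by (simp only: image_eqI)
  next
    fix c v assume "v \<in> word ` H"
    then obtain x where x: "x \<in> H" "v = word x" by blast
    then have "word_scale c v = word (pair_scale emb c x)"
      using word_pair_scale[of x c] assms(2) by (simp add: subset_eq)
    then show "word_scale c v \<in> word ` H" using P.subspace_scale[OF assms(1) x(1)] by (simp only: image_eqI)
  qed
  have "card (word ` H) = card H"
    using inj_on_subset[OF inj_on_word assms(2)] by (rule card_image)
  then have "CARD('k) ^ W.dim (word ` H) = CARD('k) ^ P.dim H"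
    using card_subspace_eq_power_dim[OF W.vector_space_axioms sub]
      card_subspace_eq_power_dim[OF P.vector_space_axioms assms(1)] by simp
  then show "W.dim (word ` H) = P.dim H"
    using CARD_field_gt_1[where 'k = 'k] by simp
qed

text \<open>Recovers the parameter space of a given subcode \<open>D\<close>.\<close>

lemma subspace_word_preimage:
  assumes "W.subspace D"
  shows "P.subspace {x \<in> F\<^sub>1 \<times> F\<^sub>2. word x \<in> D}"
proof -
  have pairs: "0 \<in> F\<^sub>1 \<times> F\<^sub>2" "x \<in> F\<^sub>1 \<times> F\<^sub>2 \<Longrightarrow> y \<in> F\<^sub>1 \<times> F\<^sub>2 \<Longrightarrow> x + y \<in> F\<^sub>1 \<times> F\<^sub>2"
    "x \<in> F\<^sub>1 \<times> F\<^sub>2 \<Longrightarrow> pair_scale emb c x \<in> F\<^sub>1 \<times> F\<^sub>2" for x y c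
    using subspace_pairs by (auto simp only: P.subspace_def)
  show ?thesis
    unfolding P.subspace_def mem_Collect_eq
    by (intro conjI ballI allI)
      (use assms pairs in \<open>auto simp only: mem_Collect_eq word_0 word_add word_pair_scale
        intro: W.subspace_0 W.subspace_add W.subspace_scale\<close>)
qed

section \<open>Supports and exponential sums\<close>

definition vanishing :: "('a \<times> 'a) set \<Rightarrow> nat" where
  "vanishing H = card {i. i < n \<and> (\<forall>h\<in>H. word h i = 0)}"

lemma card_Supp_word: "card (Supp (word ` H)) = n - vanishing H" "vanishing H \<le> n"
proof -
  let ?V = "{i. i < n \<and> (\<forall>h\<in>H. word h i = 0)}"
  have "Supp (word ` H) = {..<n} - ?V"
    by (auto simp: Supp_def word_nth split: if_splits)
  moreover have "?V \<subseteq> {..<n}" by auto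
  ultimately show "card (Supp (word ` H)) = n - vanishing H" "vanishing H \<le> n"
    using card_Diff_subset[of ?V "{..<n}"] card_mono[of "{..<n}" ?V] by (auto simp: vanishing_def)
qed

text \<open>For fixed \<open>i\<close> the entry \<open>word h i\<close> is a linear functional of
  \<open>h\<close>. Its composition with \<open>add_char\<close> is trivial on \<open>H\<close> only
  if the functional is zero there, so the sum over \<open>H\<close> is \<open>card H\<close> or
  0.\<close>

lemma sum_add_char_word:
  assumes "P.subspace H" "H \<subseteq> F\<^sub>1 \<times> F\<^sub>2"
  shows "(\<Sum>h\<in>H. \<Sum>i<n. add_char (word h i)) = of_nat (card H) * of_nat (vanishing H)"
proof -
  have inner: "(\<Sum>h\<in>H. add_char (word h i)) = (if \<forall>h\<in>H. word h i = 0 then of_nat (card H) else 0)" for i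
  proof (cases "\<forall>h\<in>H. word h i = 0")
    case False
    then obtain h where h: "h \<in> H" "word h i \<noteq> 0" by blast
    obtain a where a: "add_char a \<noteq> 1" using add_char_nontrivial by blast
    \<comment> \<open>Scaling \<open>h\<close> moves its nonzero entry at position \<open>i\<close>
      to the value \<open>a\<close>, where \<open>add_char\<close> is not 1.\<close>
    let ?h = "pair_scale emb (a / word h i) h"
    have "word ?h i = a" using h assms(2) word_pair_scale[of h] by (auto simp: word_scale_def)
    then have "(\<Sum>h\<in>H. add_char (word h i)) = 0"
      using assms a h
      by (intro sum_character_eq_0[of H _ ?h])
        (auto simp: word_add subset_eq add_char_add
          intro: P.subspace_add P.subspace_neg P.subspace_scale)
    with False show ?thesis by (simp only: if_False)
  qed (simp add: add_char_0)
  have "(\<Sum>h\<in>H. \<Sum>i<n. add_char (word h i)) = (\<Sum>i<n. \<Sum>h\<in>H. add_char (word h i))"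
    by (rule sum.swap)
  also have "\<dots> = (\<Sum>i | i < n \<and> (\<forall>h\<in>H. word h i = 0). of_nat (card H))"
    unfolding inner by (rule sum.mono_neutral_cong_right) auto
  finally show ?thesis by (simp add: vanishing_def mult.commute)
qed

text \<open>By transitivity of the trace, the exponentials in \<open>A\<close> and \<open>B\<close>
  are values of \<open>add_char\<close> at codeword entries.\<close>

lemma zeta_pow_traces:
  assumes "x \<in> F\<^sub>1" "y \<in> F\<^sub>2"
  shows "zeta_pow CHAR('a) (field_trace CHAR('a) F\<^sub>1 x) = add_char (T\<^sub>1 x)"
    and "zeta_pow CHAR('a) (field_trace CHAR('a) F\<^sub>1 x + field_trace CHAR('a) F\<^sub>2 y)
      = add_char (T\<^sub>1 x + T\<^sub>2 y)"
  using assms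
  by (simp_all add: field_trace_transitive[OF subfields(1) card_F(1)]
      field_trace_transitive[OF subfields(2) card_F(2)] add_char_def prime_trace_add)

definition transversal_subspaces :: "nat \<Rightarrow> ('a \<times> 'a) set set" where
  "transversal_subspaces j = {H. P.subspace H \<and> H \<subseteq> F\<^sub>1 \<times> F\<^sub>2 \<and> P.dim H = j \<and>
     H \<inter> ({0} \<times> F\<^sub>2) = {(0, 0)}}"

text \<open>\<open>F\<^sub>1 \<times> {0}\<close> has dimension \<open>k\<^sub>1\<close>, and its
  subspaces meet \<open>{0} \<times> F\<^sub>2\<close> trivially. Nonemptiness gives
  \<open>Max\<close> its meaning.\<close>

lemma transversal_subspaces_nonempty:
  assumes "j \<le> k\<^sub>1"
  shows "transversal_subspaces j \<noteq> {}"
proof -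
  have sub: "P.subspace (F\<^sub>1 \<times> {0})"
    by (auto simp: P.subspace_def pair_scale_def F_closed zero_prod_def)
  have "CARD('k) ^ k\<^sub>1 = CARD('k) ^ P.dim (F\<^sub>1 \<times> {0})"
    using card_subspace_eq_power_dim[OF P.vector_space_axioms sub] card_F(1)
    by (simp add: card_cartesian_product)
  then have "j \<le> P.dim (F\<^sub>1 \<times> {0})"
    using assms CARD_field_gt_1[where 'k = 'k] by simp
  then obtain H where "H \<subseteq> F\<^sub>1 \<times> {0}" "P.subspace H" "P.dim H = j"
    using exists_subspace_of_dim[OF P.vector_space_axioms sub] by blast
  then have "H \<in> transversal_subspaces j"
    using P.subspace_0[of H] F_closed by (auto simp: transversal_subspaces_def zero_prod_def)
  then show ?thesis by blast
qed

text \<open>Injectivity of \<open>word\<close> matches the admissible \<open>H\<close> with the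
  admissible \<open>D\<close>, since images then commute with intersections.\<close>

lemma support_sizes:
  "{card (Supp D) | D. W.subspace D \<and> D \<subseteq> word ` (F\<^sub>1 \<times> F\<^sub>2) \<and> W.dim D = j \<and>
      D \<inter> word ` ({0} \<times> F\<^sub>2) = {0}}
    = (\<lambda>H. n - vanishing H) ` transversal_subspaces j"
proof -
  have int: "word ` H \<inter> word ` ({0} \<times> F\<^sub>2) = {0} \<longleftrightarrow> H \<inter> ({0} \<times> F\<^sub>2) = {(0, 0)}"
    if "H \<subseteq> F\<^sub>1 \<times> F\<^sub>2" for H
  proof -
    have sub: "{0} \<times> F\<^sub>2 \<subseteq> F\<^sub>1 \<times> F\<^sub>2" using F_closed by auto
    have "word ` H \<inter> word ` ({0} \<times> F\<^sub>2) = word ` (H \<inter> ({0} \<times> F\<^sub>2))"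
      by (rule inj_on_image_Int[OF inj_on_word that sub, symmetric])
    moreover have "word ` {(0, 0)} = {0}" using word_0 by (simp add: zero_prod_def)
    moreover have "word ` (H \<inter> ({0} \<times> F\<^sub>2)) = word ` {(0, 0)} \<longleftrightarrow> H \<inter> ({0} \<times> F\<^sub>2) = {(0, 0)}"
      by (rule inj_on_image_eq_iff[OF inj_on_word]) (use that F_closed(1,5) in auto)
    ultimately show ?thesis by simp
  qed
  show ?thesis
  proof (intro equalityI subsetI)
    fix d assume "d \<in> {card (Supp D) | D. W.subspace D \<and> D \<subseteq> word ` (F\<^sub>1 \<times> F\<^sub>2) \<and> W.dim D = j \<and>
      D \<inter> word ` ({0} \<times> F\<^sub>2) = {0}}"
    then obtain D where D: "d = card (Supp D)" "W.subspace D" "D \<subseteq> word ` (F\<^sub>1 \<times> F\<^sub>2)" "W.dim D = j"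
      "D \<inter> word ` ({0} \<times> F\<^sub>2) = {0}" by blast
    let ?H = "{x \<in> F\<^sub>1 \<times> F\<^sub>2. word x \<in> D}"
    have im: "word ` ?H = D" using D(3) by blast
    have sub: "?H \<subseteq> F\<^sub>1 \<times> F\<^sub>2" by blast
    have "?H \<in> transversal_subspaces j"
      using subspace_word_preimage[OF D(2)] subspace_word_image(2)[OF _ sub] int[OF sub] D im sub
      unfolding transversal_subspaces_def by simp
    then show "d \<in> (\<lambda>H. n - vanishing H) ` transversal_subspaces j"
      using card_Supp_word(1)[of ?H] im D(1) by auto
  next
    fix d assume "d \<in> (\<lambda>H. n - vanishing H) ` transversal_subspaces j"
    then obtain H where H: "d = n - vanishing H" "P.subspace H" "H \<subseteq> F\<^sub>1 \<times> F\<^sub>2" "P.dim H = j"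
      "H \<inter> ({0} \<times> F\<^sub>2) = {(0, 0)}" by (auto simp: transversal_subspaces_def)
    then show "d \<in> {card (Supp D) | D. W.subspace D \<and> D \<subseteq> word ` (F\<^sub>1 \<times> F\<^sub>2) \<and> W.dim D = j \<and>
      D \<inter> word ` ({0} \<times> F\<^sub>2) = {0}}"
      using subspace_word_image[OF H(2,3)] int[OF H(3)] card_Supp_word(1)[of H]
      by (intro CollectI exI[of _ "word ` H"]) auto
  qed
qed

text \<open>Minimizing \<open>n - vanishing H\<close> is maximizing \<open>vanishing H\<close>; the
  truncated subtraction is exact because \<open>vanishing H \<le> n\<close>.\<close>

lemma rghw_eq:
  assumes "j \<le> k\<^sub>1"
  shows "real (rghw j (word ` (F\<^sub>1 \<times> F\<^sub>2)) (word ` ({0} \<times> F\<^sub>2)))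
    = real n - (MAX H\<in>transversal_subspaces j. real (vanishing H))"
proof -
  let ?S = "transversal_subspaces j"
  have fin: "finite ?S" by simp
  note ne = transversal_subspaces_nonempty[OF assms]
  have "Max (vanishing ` ?S) \<in> vanishing ` ?S"
    by (rule Max_in) (use fin ne in auto)
  then obtain H where H: "H \<in> ?S" "Max (vanishing ` ?S) = vanishing H" by blast
  have "Min ((\<lambda>H. n - vanishing H) ` ?S) = n - vanishing H"
  proof (rule Min_eqI)
    fix d assume "d \<in> (\<lambda>H. n - vanishing H) ` ?S"
    then obtain H' where "H' \<in> ?S" "d = n - vanishing H'" by blast
    with Max_ge[of "vanishing ` ?S" "vanishing H'"] fin H(2) show "n - vanishing H \<le> d" by auto
  qed (use fin H in auto)
  moreover have "(MAX H\<in>?S. real (vanishing H)) = real (vanishing H)"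
    by (rule Max_eqI) (use fin H Max_ge[of "vanishing ` ?S"] in auto)
  ultimately show ?thesis
    using card_Supp_word(2)[of H] by (simp add: rghw_def support_sizes of_nat_diff)
qed

text \<open>The left side is the character sum over \<open>H\<close>, by
  \<open>sum_add_char_word\<close>; the right side groups the same sum by which entries of the pair
  are zero.\<close>

lemma sum_vanishing:
  assumes "H \<in> transversal_subspaces j"
  shows "of_nat CARD('k) ^ j * of_nat (vanishing H) = (of_nat n :: complex)
    + (\<Sum>\<beta> | (\<beta>, 0) \<in> H \<and> \<beta> \<noteq> 0. \<Sum>i<n. zeta_pow CHAR('a) (field_trace CHAR('a) F\<^sub>1 (\<beta> * \<alpha>\<^sub>1 ^ i)))
    + (\<Sum>(\<beta>\<^sub>1, \<beta>\<^sub>2) | (\<beta>\<^sub>1, \<beta>\<^sub>2) \<in> H \<and> \<beta>\<^sub>1 \<noteq> 0 \<and> \<beta>\<^sub>2 \<noteq> 0. \<Sum>i<n. zeta_pow CHAR('a)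
        (field_trace CHAR('a) F\<^sub>1 (\<beta>\<^sub>1 * \<alpha>\<^sub>1 ^ i) + field_trace CHAR('a) F\<^sub>2 (\<beta>\<^sub>2 * \<alpha>\<^sub>2 ^ i)))"
proof -
  have H: "P.subspace H" "H \<subseteq> F\<^sub>1 \<times> F\<^sub>2" "P.dim H = j" "H \<inter> ({0} \<times> F\<^sub>2) = {(0, 0)}"
    using assms by (auto simp: transversal_subspaces_def)
  let ?g = "\<lambda>h. \<Sum>i<n. add_char (word h i)"
  let ?X = "{\<beta>. (\<beta>, 0) \<in> H \<and> \<beta> \<noteq> 0}" and ?Y = "{(\<beta>\<^sub>1, \<beta>\<^sub>2). (\<beta>\<^sub>1, \<beta>\<^sub>2) \<in> H \<and> \<beta>\<^sub>1 \<noteq> 0 \<and> \<beta>\<^sub>2 \<noteq> 0}"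
  \<comment> \<open>Transversality rules out pairs \<open>(0, \<beta>)\<close> with
    \<open>\<beta> \<noteq> 0\<close>.\<close>
  have "H = {(0, 0)} \<union> (\<lambda>\<beta>. (\<beta>, 0)) ` ?X \<union> ?Y"
    using H(2,4) by auto
  then have "sum ?g H = sum ?g ({(0, 0)} \<union> (\<lambda>\<beta>. (\<beta>, 0)) ` ?X \<union> ?Y)"
    by (rule arg_cong)
  also have "\<dots> = sum ?g ({(0, 0)} \<union> (\<lambda>\<beta>. (\<beta>, 0)) ` ?X) + sum ?g ?Y"
    by (rule sum.union_disjoint) auto
  also have "sum ?g ({(0, 0)} \<union> (\<lambda>\<beta>. (\<beta>, 0)) ` ?X) = sum ?g {(0, 0)} + sum ?g ((\<lambda>\<beta>. (\<beta>, 0)) ` ?X)"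
    by (rule sum.union_disjoint) auto
  also have "sum ?g {(0, 0)} = of_nat n"
    using word_0 by (simp add: zero_prod_def add_char_0)
  also have "sum ?g ((\<lambda>\<beta>. (\<beta>, 0)) ` ?X) = (\<Sum>\<beta>\<in>?X. ?g (\<beta>, 0))"
    by (subst sum.reindex) (auto simp: inj_on_def)
  also have "\<dots> = (\<Sum>\<beta>\<in>?X. \<Sum>i<n. zeta_pow CHAR('a) (field_trace CHAR('a) F\<^sub>1 (\<beta> * \<alpha>\<^sub>1 ^ i)))"
  proof (intro sum.cong refl)
    fix \<beta> i assume "\<beta> \<in> ?X" "i \<in> {..<n}"
    moreover from this have "\<beta> * \<alpha>\<^sub>1 ^ i \<in> F\<^sub>1" using H(2) alpha_power by (auto intro: F_closed)
    ultimately show "add_char (word (\<beta>, 0) i)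
      = zeta_pow CHAR('a) (field_trace CHAR('a) F\<^sub>1 (\<beta> * \<alpha>\<^sub>1 ^ i))"
      by (simp add: zeta_pow_traces(1)[OF _ F_closed(5)] word_nth trace_0)
  qed
  also have "sum ?g ?Y = (\<Sum>(\<beta>\<^sub>1, \<beta>\<^sub>2)\<in>?Y. \<Sum>i<n. zeta_pow CHAR('a)
        (field_trace CHAR('a) F\<^sub>1 (\<beta>\<^sub>1 * \<alpha>\<^sub>1 ^ i) + field_trace CHAR('a) F\<^sub>2 (\<beta>\<^sub>2 * \<alpha>\<^sub>2 ^ i)))"
  proof (rule sum.cong[OF refl], clarify, rule sum.cong[OF refl])
    fix \<beta>\<^sub>1 \<beta>\<^sub>2 i assume "(\<beta>\<^sub>1, \<beta>\<^sub>2) \<in> H" "i \<in> {..<n}"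
    moreover from this have "\<beta>\<^sub>1 * \<alpha>\<^sub>1 ^ i \<in> F\<^sub>1" "\<beta>\<^sub>2 * \<alpha>\<^sub>2 ^ i \<in> F\<^sub>2"
      using H(2) alpha_power by (auto intro: F_closed)
    ultimately show "add_char (word (\<beta>\<^sub>1, \<beta>\<^sub>2) i) = zeta_pow CHAR('a)
        (field_trace CHAR('a) F\<^sub>1 (\<beta>\<^sub>1 * \<alpha>\<^sub>1 ^ i) + field_trace CHAR('a) F\<^sub>2 (\<beta>\<^sub>2 * \<alpha>\<^sub>2 ^ i))"
      by (simp add: zeta_pow_traces(2) word_nth)
  qed
  finally show ?thesis
    using sum_add_char_word[OF H(1,2)] card_subspace_eq_power_dim[OF P.vector_space_axioms H(1)] H(3)
    by simp
qed

text \<open>The sum over \<open>l\<close> extends to all \<open>l < e\<close>, as the added inner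
  sums vanish. Fourier inversion then leaves \<open>e\<close> times a sum over one period of
  \<open>\<alpha>\<^sub>1\<close>, and \<open>n / (e * m)\<close> turns this into the sum over all
  \<open>n\<close> positions.\<close>

lemma sum_gauss_sums:
  assumes \<gamma>: "primitive_element F\<^sub>1 \<gamma>" "\<alpha>\<^sub>1 = \<gamma> ^ e" and em: "card F\<^sub>1 - 1 = e * m" and "m dvd n"
    and \<chi>: "mult_character F\<^sub>1 \<chi>" "\<chi> \<gamma> = zeta e"
    and H: "P.subspace H" "H \<subseteq> F\<^sub>1 \<times> F\<^sub>2"
  shows "of_nat n / (of_nat e * of_nat m) *
     (\<Sum>l | l \<le> e - 1 \<and> (\<forall>a. a \<noteq> 0 \<longrightarrow> \<chi> (emb a) ^ l = 1).
        gauss_sum CHAR('a) F\<^sub>1 (\<lambda>x. \<chi> x ^ l) * (\<Sum>\<beta> | (\<beta>, 0) \<in> H \<and> \<beta> \<noteq> 0. cnj (\<chi> \<beta>) ^ l))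
    = (\<Sum>\<beta> | (\<beta>, 0) \<in> H \<and> \<beta> \<noteq> 0. \<Sum>i<n. zeta_pow CHAR('a) (field_trace CHAR('a) F\<^sub>1 (\<beta> * \<alpha>\<^sub>1 ^ i)))"
proof -
  let ?S = "{\<beta>. (\<beta>, 0) \<in> H \<and> \<beta> \<noteq> 0}"
  let ?G = "\<lambda>l. gauss_sum CHAR('a) F\<^sub>1 (\<lambda>x. \<chi> x ^ l)"
  let ?f = "\<lambda>x. zeta_pow CHAR('a) (field_trace CHAR('a) F\<^sub>1 x)"
  have "{0, 1} \<subseteq> F\<^sub>1" using subfields(1) by (simp add: is_subfield_def)
  from card_mono[OF _ this] have em0: "e > 0" "m > 0" using em by (cases e; cases m; simp)+
  have S: "?S \<subseteq> F\<^sub>1 - {0}" using H(2) by auto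
  \<comment> \<open>Multiplication by \<open>emb a\<close> permutes \<open>?S\<close> and pulls out
    of the sum a factor different from 1.\<close>
  have nontrivial: "(\<Sum>\<beta>\<in>?S. cnj (\<chi> \<beta>) ^ l) = 0" if a: "a \<noteq> 0" "\<chi> (emb a) ^ l \<noteq> 1" for a l
  proof -
    have closed: "emb c * \<beta> \<in> ?S" if "c \<noteq> 0" "\<beta> \<in> ?S" for c \<beta>
      using that P.subspace_scale[OF H(1), of "(\<beta>, 0)" c] by (simp add: pair_scale_def emb_eq_0_iff)
    have inv: "emb (inverse a) * emb a = 1" using a(1) emb_mult[of "inverse a" a] by (simp add: emb_1)
    have "(\<Sum>\<beta>\<in>?S. cnj (\<chi> \<beta>) ^ l) = (\<Sum>\<beta>\<in>?S. cnj (\<chi> (emb a * \<beta>)) ^ l)"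
    proof (rule sum.reindex_bij_witness[of _ "\<lambda>\<beta>. emb a * \<beta>" "\<lambda>\<beta>. emb (inverse a) * \<beta>"])
      fix \<beta> assume \<beta>: "\<beta> \<in> ?S"
      show "emb a * (emb (inverse a) * \<beta>) = \<beta>" "emb (inverse a) * (emb a * \<beta>) = \<beta>"
        using inv by (simp_all flip: mult.assoc add: mult.commute[of "emb a" "emb (inverse a)"])
      then show "cnj (\<chi> (emb a * (emb (inverse a) * \<beta>))) ^ l = cnj (\<chi> \<beta>) ^ l" by (simp only:)
      show "emb (inverse a) * \<beta> \<in> ?S" "emb a * \<beta> \<in> ?S"
        using closed[OF _ \<beta>, of "inverse a"] closed[OF _ \<beta>, of a] a(1) by simp_all
    qed
    also have "\<dots> = (\<Sum>\<beta>\<in>?S. cnj (\<chi> (emb a) ^ l) * cnj (\<chi> \<beta>) ^ l)"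
    proof (rule sum.cong[OF refl])
      fix \<beta> assume "\<beta> \<in> ?S"
      then have "\<chi> (emb a * \<beta>) = \<chi> (emb a) * \<chi> \<beta>"
        using \<chi>(1) S a(1) F_closed(4)[of a] by (auto simp: mult_character_def emb_eq_0_iff)
      then show "cnj (\<chi> (emb a * \<beta>)) ^ l = cnj (\<chi> (emb a) ^ l) * cnj (\<chi> \<beta>) ^ l"
        by (simp add: power_mult_distrib)
    qed
    also have "\<dots> = cnj (\<chi> (emb a) ^ l) * (\<Sum>\<beta>\<in>?S. cnj (\<chi> \<beta>) ^ l)"
      by (rule sum_distrib_left[symmetric])
    finally have "(\<Sum>\<beta>\<in>?S. cnj (\<chi> \<beta>) ^ l) = cnj (\<chi> (emb a) ^ l) * (\<Sum>\<beta>\<in>?S. cnj (\<chi> \<beta>) ^ l)" .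
    moreover have "cnj (\<chi> (emb a) ^ l) \<noteq> 1" using a(2) by (metis complex_cnj_cancel_iff complex_cnj_one)
    ultimately show ?thesis by simp
  qed
  have power_m: "\<alpha>\<^sub>1 ^ m = 1"
  proof -
    have "\<gamma> \<in> F\<^sub>1 - {0}"
      using rangeI[of "\<lambda>i. \<gamma> ^ i" 1] \<gamma>(1) by (auto simp: primitive_element_def)
    then show ?thesis
      using subfield_power_card(2)[OF subfields(1), of \<gamma>] em by (simp add: \<gamma>(2) power_mult)
  qed
  \<comment> \<open>The \<open>n\<close> positions consist of \<open>c\<close> full periods of
    length \<open>m\<close>.\<close>
  obtain c where c: "n = c * m" using \<open>m dvd n\<close> by (auto simp: dvd_def mult.commute)
  have orbit: "(\<Sum>i<n. ?f (\<beta> * \<alpha>\<^sub>1 ^ i)) = of_nat c * (\<Sum>t<m. ?f (\<beta> * \<alpha>\<^sub>1 ^ t))" for \<beta>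
  proof -
    have "\<alpha>\<^sub>1 ^ (u * m + t) = \<alpha>\<^sub>1 ^ t" for u t
      by (simp add: power_add mult.commute[of u] power_mult power_m)
    then show ?thesis unfolding c sum_lessThan_mult by simp
  qed
  have "(\<Sum>l | l \<le> e - 1 \<and> (\<forall>a. a \<noteq> 0 \<longrightarrow> \<chi> (emb a) ^ l = 1). ?G l * (\<Sum>\<beta>\<in>?S. cnj (\<chi> \<beta>) ^ l))
    = (\<Sum>l<e. ?G l * (\<Sum>\<beta>\<in>?S. cnj (\<chi> \<beta>) ^ l))"
    \<comment> \<open>For \<open>e > 0\<close> the ranges \<open>l \<le> e - 1\<close> and
      \<open>l < e\<close> agree.\<close>
    by (rule sum.mono_neutral_left) (use em0 nontrivial in auto)
  also have "\<dots> = (\<Sum>\<beta>\<in>?S. \<Sum>l<e. ?G l * cnj (\<chi> \<beta>) ^ l)"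
    unfolding sum_distrib_left by (rule sum.swap)
  also have "\<dots> = (\<Sum>\<beta>\<in>?S. of_nat e * (\<Sum>t<m. ?f (\<beta> * \<alpha>\<^sub>1 ^ t)))"
    unfolding gauss_sum_def \<gamma>(2)
    by (rule sum.cong[OF refl], rule sum_character_powers[OF subfields(1) _ \<gamma>(1) em \<chi>])
      (use S in auto)
  finally have "of_nat n / (of_nat e * of_nat m) *
     (\<Sum>l | l \<le> e - 1 \<and> (\<forall>a. a \<noteq> 0 \<longrightarrow> \<chi> (emb a) ^ l = 1). ?G l * (\<Sum>\<beta>\<in>?S. cnj (\<chi> \<beta>) ^ l))
    = (\<Sum>\<beta>\<in>?S. of_nat n / (of_nat e * of_nat m) * (of_nat e * (\<Sum>t<m. ?f (\<beta> * \<alpha>\<^sub>1 ^ t))))"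
    by (simp only: sum_distrib_left)
  also have "\<dots> = (\<Sum>\<beta>\<in>?S. \<Sum>i<n. ?f (\<beta> * \<alpha>\<^sub>1 ^ i))"
    unfolding orbit using em0 by (simp add: c)
  finally show ?thesis .
qed

end

section \<open>The weight formula\<close>

text \<open>A maximum of complex expressions needs them to be real, so the conclusion asserts that
  \<open>val H\<close> is real on \<open>\<H>\<close> and maximizes
  \<open>Re (val H)\<close>.\<close>

theorem mainTheorem2:
  fixes emb :: "'k::{field,finite} \<Rightarrow> 'a::{field,finite}"
    and \<alpha>\<^sub>1 \<alpha>\<^sub>2 \<gamma>\<^sub>1 \<gamma>\<^sub>2 :: 'a
    and F\<^sub>1 F\<^sub>2 :: "'a set"
    and p q k\<^sub>1 k\<^sub>2 n\<^sub>1 n\<^sub>2 e\<^sub>1 e\<^sub>2 n j :: nat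
    and C C' :: "(nat \<Rightarrow> 'k) set"
    and \<chi> :: "'a \<Rightarrow> complex"
    and \<H> :: "('a \<times> 'a) set set"
    and A B val :: "('a \<times> 'a) set \<Rightarrow> complex"
  assumes "field_embedding emb"
    and "p = CHAR('k)" and "q = CARD('k)"
    and "\<alpha>\<^sub>1 \<noteq> 0" and "\<alpha>\<^sub>2 \<noteq> 0" and "\<not> conjugate_over emb \<alpha>\<^sub>1 \<alpha>\<^sub>2"
    and "n\<^sub>1 = mult_order \<alpha>\<^sub>1" and "n\<^sub>2 = mult_order \<alpha>\<^sub>2"
    and "F\<^sub>1 = adjoin emb \<alpha>\<^sub>1" and "F\<^sub>2 = adjoin emb \<alpha>\<^sub>2"
    and "card F\<^sub>1 = q ^ k\<^sub>1" and "card F\<^sub>2 = q ^ k\<^sub>2"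
    and "primitive_element F\<^sub>1 \<gamma>\<^sub>1" and "primitive_element F\<^sub>2 \<gamma>\<^sub>2"
    and "\<alpha>\<^sub>1 = \<gamma>\<^sub>1 ^ e\<^sub>1" and "\<alpha>\<^sub>2 = \<gamma>\<^sub>2 ^ e\<^sub>2"
    and "card F\<^sub>1 - 1 = e\<^sub>1 * n\<^sub>1" and "card F\<^sub>2 - 1 = e\<^sub>2 * n\<^sub>2"
    and "n = n\<^sub>1 * n\<^sub>2 div gcd n\<^sub>1 n\<^sub>2"
    and "C = {cyclic_word emb n F\<^sub>1 \<alpha>\<^sub>1 F\<^sub>2 \<alpha>\<^sub>2 \<beta>\<^sub>1 \<beta>\<^sub>2 | \<beta>\<^sub>1 \<beta>\<^sub>2. \<beta>\<^sub>1 \<in> F\<^sub>1 \<and> \<beta>\<^sub>2 \<in> F\<^sub>2}"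
    and "C' = {cyclic_word emb n F\<^sub>1 \<alpha>\<^sub>1 F\<^sub>2 \<alpha>\<^sub>2 0 \<beta>\<^sub>2 | \<beta>\<^sub>2. \<beta>\<^sub>2 \<in> F\<^sub>2}"
    and "mult_character F\<^sub>1 \<chi>" and "\<chi> \<gamma>\<^sub>1 = zeta e\<^sub>1"
    and "1 \<le> j" and "j \<le> k\<^sub>1"
    and "\<H> = {H. module.subspace (pair_scale emb) H \<and> H \<subseteq> F\<^sub>1 \<times> F\<^sub>2 \<and>
                 vector_space.dim (pair_scale emb) H = j \<and> H \<inter> ({0} \<times> F\<^sub>2) = {(0, 0)}}"
    and "\<And>H. A H = of_nat n / (of_nat e\<^sub>1 * of_nat n\<^sub>1) *
           (\<Sum>l | l \<le> e\<^sub>1 - 1 \<and> (\<forall>a. a \<noteq> 0 \<longrightarrow> \<chi> (emb a) ^ l = 1).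
              gauss_sum p F\<^sub>1 (\<lambda>x. \<chi> x ^ l) *
              (\<Sum>\<beta>\<^sub>1 | (\<beta>\<^sub>1, 0) \<in> H \<and> \<beta>\<^sub>1 \<noteq> 0. cnj (\<chi> \<beta>\<^sub>1) ^ l))"
    and "\<And>H. B H =
           (\<Sum>(\<beta>\<^sub>1, \<beta>\<^sub>2) | (\<beta>\<^sub>1, \<beta>\<^sub>2) \<in> H \<and> \<beta>\<^sub>1 \<noteq> 0 \<and> \<beta>\<^sub>2 \<noteq> 0.
              \<Sum>i<n. zeta_pow p
                (field_trace p F\<^sub>1 (\<beta>\<^sub>1 * \<alpha>\<^sub>1 ^ i) + field_trace p F\<^sub>2 (\<beta>\<^sub>2 * \<alpha>\<^sub>2 ^ i)))"
    and "\<And>H. val H = of_nat n / of_nat q ^ j + 1 / of_nat q ^ j * (A H + B H)"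
  shows "(\<forall>H\<in>\<H>. val H \<in> \<real>) \<and>
         real (rghw j C C') = real n - (MAX H\<in>\<H>. Re (val H))"
proof -
  have card_pos: "0 < card L - 1" if "is_subfield L" for L :: "'a set"
  proof -
    have "{0, 1} \<subseteq> L" using that by (simp add: is_subfield_def)
    from card_mono[OF _ this] show ?thesis by simp
  qed
  note emb = assms(1) and F = assms(9,10) and order_eq = assms(17,18)
  interpret E: finite_field_extension emb by unfold_locales (rule emb)
  have sub: "is_subfield F\<^sub>1" "is_subfield F\<^sub>2" by (simp_all add: F E.subfield_adjoin)
  have pos: "e\<^sub>1 > 0" "n\<^sub>1 > 0" "n\<^sub>2 > 0"
    using card_pos[OF sub(1)] card_pos[OF sub(2)] unfolding order_eq by simp_all
  have lcm: "n = lcm n\<^sub>1 n\<^sub>2" using assms(19) by (simp add: lcm_nat_def)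
  \<comment> \<open>Each power equals that of a primitive element with exponent
    \<open>card F\<^sub>1 - 1\<close> or \<open>card F\<^sub>2 - 1\<close>.\<close>
  have power_order: "\<alpha>\<^sub>1 ^ n\<^sub>1 = 1" "\<alpha>\<^sub>2 ^ n\<^sub>2 = 1"
    using assms(15,16) subfield_power_card(2)[OF sub(1), of \<gamma>\<^sub>1] subfield_power_card(2)[OF sub(2), of \<gamma>\<^sub>2]
      rangeI[of "\<lambda>i. \<gamma>\<^sub>1 ^ i" 1] rangeI[of "\<lambda>i. \<gamma>\<^sub>2 ^ i" 1] assms(13,14) order_eq
    by (auto simp: primitive_element_def power_mult[symmetric])
  have "x ^ n = 1" if "x ^ m = 1" "m dvd n" for x :: 'a and m
    using that by (elim dvdE) (simp add: power_mult)
  then have power_n: "\<alpha>\<^sub>1 ^ n = 1" "\<alpha>\<^sub>2 ^ n = 1"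
    using power_order by (simp_all add: lcm)
  interpret cyclic_code_pair emb \<alpha>\<^sub>1 \<alpha>\<^sub>2 F\<^sub>1 F\<^sub>2 k\<^sub>1 k\<^sub>2 n
    by unfold_locales (use F assms(3,6,11,12) power_n pos lcm in \<open>simp_all add: lcm_pos_nat\<close>)
  have p: "p = CHAR('a)" using assms(2) E.CHAR_emb by simp
  have \<H>: "\<H> = transversal_subspaces j"
    using assms(26) by (simp add: transversal_subspaces_def)
  have codes: "C = word ` (F\<^sub>1 \<times> F\<^sub>2)" "C' = word ` ({0} \<times> F\<^sub>2)"
    unfolding assms(20,21) word_def by (rule set_eqI, simp add: image_iff Bex_def, blast)+
  \<comment> \<open>The complex expression is a count of positions, which gives both the reality and
    the value of the maximum.\<close>
  have val: "val H = of_nat (vanishing H)" if H: "H \<in> \<H>" for H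
  proof -
    have "P.subspace H" "H \<subseteq> F\<^sub>1 \<times> F\<^sub>2" using H \<H> by (auto simp: transversal_subspaces_def)
    moreover have "n\<^sub>1 dvd n" by (simp add: lcm)
    ultimately have "A H = (\<Sum>\<beta> | (\<beta>, 0) \<in> H \<and> \<beta> \<noteq> 0. \<Sum>i<n.
        zeta_pow p (field_trace p F\<^sub>1 (\<beta> * \<alpha>\<^sub>1 ^ i)))"
      unfolding assms(27) p
      by (intro sum_gauss_sums[OF assms(13,15,17) _ assms(22,23)])
    then have "of_nat n + (A H + B H) = of_nat q ^ j * (of_nat (vanishing H) :: complex)"
      using sum_vanishing[of H j] H \<H> by (simp add: assms(3,28) p add.assoc)
    moreover have "(of_nat q :: complex) ^ j \<noteq> 0" by (simp add: assms(3))
    ultimately show ?thesis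
      unfolding assms(29) by (simp add: field_simps)
  qed
  have "(MAX H\<in>\<H>. Re (val H)) = (MAX H\<in>\<H>. real (vanishing H))"
    by (rule arg_cong[of _ _ Max], rule image_cong) (simp_all add: val)
  then show ?thesis
    using rghw_eq[OF assms(25)] val by (simp add: codes \<H>)
qed

end
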